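(* There is a computable structure $\mathcal{A}$ (for a computable language) such that the orbits, under the automorphism group of $\mathcal{A}$, of all finite tuples from $\mathcal{A}$ are defined in $\mathcal{A}$ by computable $\Sigma_1$ (even finitary quantifier-free) formulas without parameters, but $\mathcal{A}$ has no computable $\Pi_2$ Scott sentence.
   Context: Structures are countably infinite with universe $\omega$; a structure for a computable language is computable if its atomic diagram is computable. Computable infinitary formulas (with finitely many free variables) at low levels: a formula is computable $\Sigma_0$ and computable $\Pi_0$ if it is finitary quantifier-free. For $n>0$, a computable $\Sigma_n$ formula $\varphi(\bar x)$ is the disjunction of a c.e. set (of indices) of formulas $(\exists\bar u)\psi(\bar x,\bar u)$ with each $\psi$ computable $\Pi_m$ for some $m<n$; a computable $\Pi_n$ formula $\varphi(\bar x)$ is the conjunction of a c.e. set (of indices) of formulas $(\forall\bar u)\psi(\bar x,\bar u)$ with each $\psi$ computable $\Sigma_m$ for some $m<n$. A Scott sentence for $\mathcal{A}$ is a sentence of $L_{\omega_1\omega}$ whose countable models are exactly the isomorphic copies of $\mathcal{A}$. *)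

theory Defs
  imports "HOL-Library.Nat_Bijection" "HOL-Library.Countable_Set_Type"
begin

section \<open>Partial computable functions\<close>

text \<open>Partial computable functions are the unary partial recursive functions on the natural
  numbers, with the pairing function \<^const>\<open>prod_encode\<close> and its projections among the initial
  functions; functions of several arguments are obtained through pairing.\<close>

datatype prog =
    Zero | Succ | Fst | Snd
  | Pair prog prog
  | Comp prog prog
  | Prec prog prog
  | Mu prog

primrec run :: "prog \<Rightarrow> nat \<Rightarrow> nat option" where
  "run Zero x = Some 0"
| "run Succ x = Some (Suc x)"
| "run Fst x = Some (fst (prod_decode x))"
| "run Snd x = Some (snd (prod_decode x))"
| "run (Pair p q) x =
     Option.bind (run p x) (\<lambda>a. Option.bind (run q x) (\<lambda>b. Some (prod_encode (a, b))))"
| "run (Comp p q) x = Option.bind (run q x) (run p)"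
| "run (Prec p q) x =
     (let (a, n) = prod_decode x in
        rec_nat (run p a)
          (\<lambda>y r. Option.bind r (\<lambda>v. run q (prod_encode (a, prod_encode (y, v))))) n)"
| "run (Mu p) x =
     (let P = (\<lambda>m. run p (prod_encode (x, m)) = Some 0 \<and>
                   (\<forall>j<m. run p (prod_encode (x, j)) \<noteq> None))
      in if \<exists>m. P m then Some (LEAST m. P m) else None)"

primrec prog_code :: "prog \<Rightarrow> nat" where
  "prog_code Zero = prod_encode (0, 0)"
| "prog_code Succ = prod_encode (1, 0)"
| "prog_code Fst = prod_encode (2, 0)"
| "prog_code Snd = prod_encode (3, 0)"
| "prog_code (Pair p q) = prod_encode (4, prod_encode (prog_code p, prog_code q))"
| "prog_code (Comp p q) = prod_encode (5, prod_encode (prog_code p, prog_code q))"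
| "prog_code (Prec p q) = prod_encode (6, prod_encode (prog_code p, prog_code q))"
| "prog_code (Mu p) = prod_encode (7, prog_code p)"

lemma prog_code_inject: "prog_code p = prog_code q \<Longrightarrow> p = q"
proof (induction p arbitrary: q)
  case Zero then show ?case by (cases q) auto
next
  case Succ then show ?case by (cases q) auto
next
  case Fst then show ?case by (cases q) auto
next
  case Snd then show ?case by (cases q) auto
next
  case (Pair p1 p2) then show ?case by (cases q) auto
next
  case (Comp p1 p2) then show ?case by (cases q) auto
next
  case (Prec p1 p2) then show ?case by (cases q) auto
next
  case (Mu p) then show ?case by (cases q) auto
qed

text \<open>The c.e. set with index \<open>e\<close>; numbers that are not codes of programs index the empty set.\<close>

definition W :: "nat \<Rightarrow> nat set" where
  "W e = {x. \<exists>p. prog_code p = e \<and> run p x \<noteq> None}"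

definition computable_set :: "nat set \<Rightarrow> bool" where
  "computable_set S \<longleftrightarrow> (\<exists>p. \<forall>x. run p x = Some (if x \<in> S then 1 else 0))"

definition computable_on :: "nat set \<Rightarrow> (nat \<Rightarrow> nat) \<Rightarrow> bool" where
  "computable_on S f \<longleftrightarrow> (\<exists>p. \<forall>x\<in>S. run p x = Some (f x))"


section \<open>Languages and structures\<close>

text \<open>Symbols are natural numbers; constants are function symbols of arity 0.\<close>

record lang =
  Rels :: "nat set"
  Funs :: "nat set"
  rel_arity :: "nat \<Rightarrow> nat"
  fun_arity :: "nat \<Rightarrow> nat"

definition computable_lang :: "lang \<Rightarrow> bool" where
  "computable_lang L \<longleftrightarrow>
     computable_set (Rels L) \<and> computable_set (Funs L) \<and>
     computable_on (Rels L) (rel_arity L) \<and> computable_on (Funs L) (fun_arity L)"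

text \<open>The universe is always the set of all natural numbers. Values at symbols outside the language,
  or at tuples of the wrong length, are meaningless and never consulted below.\<close>

record struct =
  rel :: "nat \<Rightarrow> nat list \<Rightarrow> bool"
  func :: "nat \<Rightarrow> nat list \<Rightarrow> nat"

definition isomorphism :: "lang \<Rightarrow> struct \<Rightarrow> struct \<Rightarrow> (nat \<Rightarrow> nat) \<Rightarrow> bool" where
  "isomorphism L A B h \<longleftrightarrow>
     bij h \<and>
     (\<forall>r\<in>Rels L. \<forall>as. length as = rel_arity L r \<longrightarrow> (rel A r as \<longleftrightarrow> rel B r (map h as))) \<and>
     (\<forall>g\<in>Funs L. \<forall>as. length as = fun_arity L g \<longrightarrow> h (func A g as) = func B g (map h as))"

definition isomorphic :: "lang \<Rightarrow> struct \<Rightarrow> struct \<Rightarrow> bool" where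
  "isomorphic L A B \<longleftrightarrow> (\<exists>h. isomorphism L A B h)"

definition orbit :: "lang \<Rightarrow> struct \<Rightarrow> nat list \<Rightarrow> nat list set" where
  "orbit L A as = {map h as | h. isomorphism L A A h}"


section \<open>Finitary quantifier-free formulas\<close>

datatype tm = Var nat | App nat "tm list"

primrec tm_over :: "lang \<Rightarrow> tm \<Rightarrow> bool" where
  "tm_over L (Var i) = True"
| "tm_over L (App g ts) =
     (g \<in> Funs L \<and> length ts = fun_arity L g \<and> (\<forall>b\<in>set (map (tm_over L) ts). b))"

primrec tm_vars :: "tm \<Rightarrow> nat set" where
  "tm_vars (Var i) = {i}"
| "tm_vars (App g ts) = \<Union>(set (map tm_vars ts))"

primrec tm_val :: "struct \<Rightarrow> (nat \<Rightarrow> nat) \<Rightarrow> tm \<Rightarrow> nat" where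
  "tm_val A v (Var i) = v i"
| "tm_val A v (App g ts) = func A g (map (tm_val A v) ts)"

primrec tm_code :: "tm \<Rightarrow> nat" where
  "tm_code (Var i) = prod_encode (0, i)"
| "tm_code (App g ts) = prod_encode (1, prod_encode (g, list_encode (map tm_code ts)))"

datatype qf =
    Fls
  | Eq tm tm
  | Rel nat "tm list"
  | Neg qf
  | And qf qf
  | Or qf qf

primrec qf_over :: "lang \<Rightarrow> qf \<Rightarrow> bool" where
  "qf_over L Fls = True"
| "qf_over L (Eq s t) = (tm_over L s \<and> tm_over L t)"
| "qf_over L (Rel r ts) =
     (r \<in> Rels L \<and> length ts = rel_arity L r \<and> (\<forall>t\<in>set ts. tm_over L t))"
| "qf_over L (Neg p) = qf_over L p"
| "qf_over L (And p q) = (qf_over L p \<and> qf_over L q)"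
| "qf_over L (Or p q) = (qf_over L p \<and> qf_over L q)"

primrec qf_vars :: "qf \<Rightarrow> nat set" where
  "qf_vars Fls = {}"
| "qf_vars (Eq s t) = tm_vars s \<union> tm_vars t"
| "qf_vars (Rel r ts) = (\<Union>t\<in>set ts. tm_vars t)"
| "qf_vars (Neg p) = qf_vars p"
| "qf_vars (And p q) = qf_vars p \<union> qf_vars q"
| "qf_vars (Or p q) = qf_vars p \<union> qf_vars q"

primrec qf_sat :: "struct \<Rightarrow> (nat \<Rightarrow> nat) \<Rightarrow> qf \<Rightarrow> bool" where
  "qf_sat A v Fls = False"
| "qf_sat A v (Eq s t) = (tm_val A v s = tm_val A v t)"
| "qf_sat A v (Rel r ts) = rel A r (map (tm_val A v) ts)"
| "qf_sat A v (Neg p) = (\<not> qf_sat A v p)"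
| "qf_sat A v (And p q) = (qf_sat A v p \<and> qf_sat A v q)"
| "qf_sat A v (Or p q) = (qf_sat A v p \<or> qf_sat A v q)"

primrec qf_code :: "qf \<Rightarrow> nat" where
  "qf_code Fls = prod_encode (0, 0)"
| "qf_code (Eq s t) = prod_encode (1, prod_encode (tm_code s, tm_code t))"
| "qf_code (Rel r ts) = prod_encode (2, prod_encode (r, list_encode (map tm_code ts)))"
| "qf_code (Neg p) = prod_encode (3, qf_code p)"
| "qf_code (And p q) = prod_encode (4, prod_encode (qf_code p, qf_code q))"
| "qf_code (Or p q) = prod_encode (5, prod_encode (qf_code p, qf_code q))"

lemma tm_code_inject: "tm_code s = tm_code t \<Longrightarrow> s = t"
proof (induction s arbitrary: t)
  case (Var i) then show ?case by (cases t) auto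
next
  case (App g ss)
  then obtain ts where t: "t = App g ts" and eq: "map tm_code ss = map tm_code ts"
    by (cases t) (auto simp: list_encode_eq)
  have "ss = ts"
    by (rule list.inj_map_strong [OF _ eq]) (rule App.IH)
  with t show ?case by simp
qed

lemma qf_code_inject: "qf_code p = qf_code q \<Longrightarrow> p = q"
proof (induction p arbitrary: q)
  case Fls then show ?case by (cases q) auto
next
  case (Eq s t) then show ?case by (cases q) (auto dest: tm_code_inject)
next
  case (Rel r ts)
  have "inj tm_code" by (rule injI) (rule tm_code_inject)
  with Rel show ?case by (cases q) (auto simp: list_encode_eq inj_map_eq_map)
next
  case (Neg p) then show ?case by (cases q) auto
next
  case (And p1 p2) then show ?case by (cases q) auto
next
  case (Or p1 p2) then show ?case by (cases q) auto
qed

text \<open>In the atomic diagram the variable \<open>Var i\<close> serves as the name of the element \<open>i\<close>, that is,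
  variables are interpreted by the identity assignment.\<close>

primrec atomic :: "qf \<Rightarrow> bool" where
  "atomic Fls = False"
| "atomic (Eq s t) = True"
| "atomic (Rel r ts) = True"
| "atomic (Neg p) = False"
| "atomic (And p q) = False"
| "atomic (Or p q) = False"

definition atomic_diagram :: "lang \<Rightarrow> struct \<Rightarrow> qf set" where
  "atomic_diagram L A =
     {p. (atomic p \<or> (\<exists>q. atomic q \<and> p = Neg q)) \<and> qf_over L p \<and> qf_sat A id p}"

definition computable_struct :: "lang \<Rightarrow> struct \<Rightarrow> bool" where
  "computable_struct L A \<longleftrightarrow> computable_set (qf_code ` atomic_diagram L A)"


section \<open>Infinitary formulas\<close>

text \<open>Formulas of $L_{\omega_1\omega}$: conjunctions and disjunctions are taken over countable sets
  of formulas. Finitely many free variables are imposed separately, where needed.\<close>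

datatype inf_fm =
    QF qf
  | Ex nat inf_fm
  | All nat inf_fm
  | Disj "inf_fm cset"
  | Conj "inf_fm cset"

primrec inf_over :: "lang \<Rightarrow> inf_fm \<Rightarrow> bool" where
  "inf_over L (QF p) = qf_over L p"
| "inf_over L (Ex i \<phi>) = inf_over L \<phi>"
| "inf_over L (All i \<phi>) = inf_over L \<phi>"
| "inf_over L (Disj S) = (\<forall>b\<in>rcset (cimage (inf_over L) S). b)"
| "inf_over L (Conj S) = (\<forall>b\<in>rcset (cimage (inf_over L) S). b)"

primrec free_vars :: "inf_fm \<Rightarrow> nat set" where
  "free_vars (QF p) = qf_vars p"
| "free_vars (Ex i \<phi>) = free_vars \<phi> - {i}"
| "free_vars (All i \<phi>) = free_vars \<phi> - {i}"
| "free_vars (Disj S) = \<Union>(rcset (cimage free_vars S))"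
| "free_vars (Conj S) = \<Union>(rcset (cimage free_vars S))"

primrec sat :: "struct \<Rightarrow> inf_fm \<Rightarrow> (nat \<Rightarrow> nat) \<Rightarrow> bool" where
  "sat A (QF p) = (\<lambda>v. qf_sat A v p)"
| "sat A (Ex i \<phi>) = (\<lambda>v. \<exists>a. sat A \<phi> (v(i := a)))"
| "sat A (All i \<phi>) = (\<lambda>v. \<forall>a. sat A \<phi> (v(i := a)))"
| "sat A (Disj S) = (\<lambda>v. \<exists>P\<in>rcset (cimage (sat A) S). P v)"
| "sat A (Conj S) = (\<lambda>v. \<forall>P\<in>rcset (cimage (sat A) S). P v)"

lemma sat_Disj_iff: "sat A (Disj S) v \<longleftrightarrow> (\<exists>\<phi>\<in>rcset S. sat A \<phi> v)"
  by (simp add: cimage.rep_eq)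

lemma sat_Conj_iff: "sat A (Conj S) v \<longleftrightarrow> (\<forall>\<phi>\<in>rcset S. sat A \<phi> v)"
  by (simp add: cimage.rep_eq)

text \<open>The set of tuples of length \<open>k\<close> defined in \<open>A\<close> by a formula whose free variables are among
  \<open>Var 0, \<dots>, Var (k - 1)\<close>; the value 0 for the remaining variables is irrelevant.\<close>

definition defined_set :: "struct \<Rightarrow> nat \<Rightarrow> inf_fm \<Rightarrow> nat list set" where
  "defined_set A k \<phi> = {bs. length bs = k \<and> sat A \<phi> (\<lambda>i. if i < k then bs ! i else 0)}"

definition qf_formula :: "lang \<Rightarrow> nat \<Rightarrow> inf_fm \<Rightarrow> bool" where
  "qf_formula L k \<phi> \<longleftrightarrow> (\<exists>p. \<phi> = QF p \<and> qf_over L p \<and> qf_vars p \<subseteq> {..<k})"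

definition is_sentence :: "lang \<Rightarrow> inf_fm \<Rightarrow> bool" where
  "is_sentence L \<phi> \<longleftrightarrow> inf_over L \<phi> \<and> free_vars \<phi> = {}"

definition models :: "struct \<Rightarrow> inf_fm \<Rightarrow> bool" where
  "models A \<phi> \<longleftrightarrow> (\<forall>v. sat A \<phi> v)"

text \<open>Since structures are countably infinite with universe $\omega$ by convention, countable models
  range over all of type \<^typ>\<open>struct\<close>. For an infinite \<open>A\<close>, every sentence that is a Scott sentence
  when finite models are also taken into account is one in this sense.\<close>

definition scott_sentence :: "lang \<Rightarrow> struct \<Rightarrow> inf_fm \<Rightarrow> bool" where
  "scott_sentence L A \<phi> \<longleftrightarrow> is_sentence L \<phi> \<and> (\<forall>B. models B \<phi> \<longleftrightarrow> isomorphic L A B)"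


section \<open>Computable infinitary formulas\<close>

text \<open>The quantifier blocks binding the variables \<open>Var k, \<dots>, Var (k + j - 1)\<close>.\<close>

definition Exs :: "nat \<Rightarrow> nat \<Rightarrow> inf_fm \<Rightarrow> inf_fm" where
  "Exs k j \<phi> = foldr Ex [k..<k + j] \<phi>"

definition Alls :: "nat \<Rightarrow> nat \<Rightarrow> inf_fm \<Rightarrow> inf_fm" where
  "Alls k j \<phi> = foldr All [k..<k + j] \<phi>"

text \<open>\<open>Sigma_index L k n e \<phi>\<close> states that \<open>\<phi>\<close> is the computable $\Sigma_n$ formula with index \<open>e\<close> in the
  free variables \<open>Var 0, \<dots>, Var (k - 1)\<close>, and likewise for \<open>Pi_index\<close>. Up to renaming of bound
  variables, the disjuncts (conjuncts) of such a formula quantify the next \<open>j\<close> variables; a disjunct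
  is presented by the code of the triple \<open>(j, m, i)\<close>, where \<open>i\<close> is an index of its matrix as a
  computable $\Pi_m$ ($\Sigma_m$) formula. The function \<open>D\<close> maps such a code to the disjunct
  (conjunct) it presents. For \<open>n > 0\<close> every member of \<open>W e\<close> has to be the code of a legitimate
  disjunct (conjunct).\<close>

inductive Sigma_index :: "lang \<Rightarrow> nat \<Rightarrow> nat \<Rightarrow> nat \<Rightarrow> inf_fm \<Rightarrow> bool"
  and Pi_index :: "lang \<Rightarrow> nat \<Rightarrow> nat \<Rightarrow> nat \<Rightarrow> inf_fm \<Rightarrow> bool"
  for L :: lang
  where
  Sigma_0: "qf_over L p \<Longrightarrow> qf_vars p \<subseteq> {..<k} \<Longrightarrow> Sigma_index L k 0 (qf_code p) (QF p)"
| Pi_0: "qf_over L p \<Longrightarrow> qf_vars p \<subseteq> {..<k} \<Longrightarrow> Pi_index L k 0 (qf_code p) (QF p)"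
| Sigma_pos:
    "0 < n \<Longrightarrow>
     (\<forall>z\<in>W e. \<exists>j m i \<psi>. z = prod_encode (j, prod_encode (m, i)) \<and> m < n \<and>
        Pi_index L (k + j) m i \<psi> \<and> D z = Exs k j \<psi>) \<Longrightarrow>
     rcset S = D ` W e \<Longrightarrow>
     Sigma_index L k n e (Disj S)"
| Pi_pos:
    "0 < n \<Longrightarrow>
     (\<forall>z\<in>W e. \<exists>j m i \<psi>. z = prod_encode (j, prod_encode (m, i)) \<and> m < n \<and>
        Sigma_index L (k + j) m i \<psi> \<and> D z = Alls k j \<psi>) \<Longrightarrow>
     rcset S = D ` W e \<Longrightarrow>
     Pi_index L k n e (Conj S)"

definition computable_Sigma :: "lang \<Rightarrow> nat \<Rightarrow> nat \<Rightarrow> inf_fm \<Rightarrow> bool" where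
  "computable_Sigma L n k \<phi> \<longleftrightarrow> (\<exists>e. Sigma_index L k n e \<phi>)"

definition computable_Pi :: "lang \<Rightarrow> nat \<Rightarrow> nat \<Rightarrow> inf_fm \<Rightarrow> bool" where
  "computable_Pi L n k \<phi> \<longleftrightarrow> (\<exists>e. Pi_index L k n e \<phi>)"

end

theory Submission
  imports Defs
begin

text \<open>The structure has unary predicates only. Element \<open>s\<close> satisfies a finite set of predicates \<open>T s\<close>
  with maximum \<open>s\<close>, and the sequence \<open>T\<close> is computable and converges to an infinite limit \<open>b\<close>. So
  each \<open>T s\<close> is an isolated point of the set of realized types, every element is defined by
  finitely many literals, and the structure is rigid. The limit \<open>b\<close> is chosen 1-generic (and
  \<open>\<Delta>\<^sub>2\<close>, hence approximable by a computable sequence). Let \<open>B\<close> be the structure with one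
  additional element of type \<open>b\<close>. If a computable $\Sigma_1$ formula holds of all tuples of \<open>A\<close>, then
  for a tuple of \<open>B\<close> the finite strings that force the formula, when read as initial segments of the
  type of the additional element, form a c.e. set containing initial segments of almost all \<open>T s\<close>.
  By genericity it contains an initial segment of \<open>b\<close>. Hence \<open>B\<close> satisfies every computable $\Pi_2$
  sentence true in \<open>A\<close>, although \<open>b\<close> is not realized in \<open>A\<close>.\<close>

section \<open>Total recursive functions and decidable predicates\<close>

definition pi1 :: "nat \<Rightarrow> nat" where "pi1 z = fst (prod_decode z)"
definition pi2 :: "nat \<Rightarrow> nat" where "pi2 z = snd (prod_decode z)"

lemma pi_prod_encode [simp]:
  "pi1 (prod_encode (a, b)) = a" "pi2 (prod_encode (a, b)) = b"
  by (simp_all add: pi1_def pi2_def)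

lemma prod_encode_pi [simp]: "prod_encode (pi1 z, pi2 z) = z"
  by (simp add: pi1_def pi2_def)

lemma prod_decode_pi: "prod_decode z = (pi1 z, pi2 z)"
  by (simp add: pi1_def pi2_def)

definition recursive :: "(nat \<Rightarrow> nat) \<Rightarrow> bool" where
  "recursive f \<longleftrightarrow> (\<exists>p. \<forall>x. run p x = Some (f x))"

definition decidable :: "(nat \<Rightarrow> bool) \<Rightarrow> bool" where
  "decidable P \<longleftrightarrow> recursive (\<lambda>x. if P x then 1 else 0)"

lemma recursive_id: "recursive (\<lambda>x. x)"
  unfolding recursive_def by (rule exI [of _ "Pair Fst Snd"]) simp

lemma recursive_Suc: "recursive f \<Longrightarrow> recursive (\<lambda>x. Suc (f x))"
  unfolding recursive_def by (elim exE, rule_tac x = "Comp Succ p" in exI) simp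

lemma recursive_pi1: "recursive f \<Longrightarrow> recursive (\<lambda>x. pi1 (f x))"
  unfolding recursive_def pi1_def by (elim exE, rule_tac x = "Comp Fst p" in exI) simp

lemma recursive_pi2: "recursive f \<Longrightarrow> recursive (\<lambda>x. pi2 (f x))"
  unfolding recursive_def pi2_def by (elim exE, rule_tac x = "Comp Snd p" in exI) simp

lemma recursive_const: "recursive (\<lambda>_. c)"
proof (induction c)
  case 0
  show ?case unfolding recursive_def by (rule exI [of _ Zero]) simp
qed (rule recursive_Suc)

lemma recursive_prod_encode:
  "recursive f \<Longrightarrow> recursive g \<Longrightarrow> recursive (\<lambda>x. prod_encode (f x, g x))"
  unfolding recursive_def by (elim exE, rule_tac x = "Pair p pa" in exI) simp

lemma recursive_compose: "recursive f \<Longrightarrow> recursive g \<Longrightarrow> recursive (\<lambda>x. f (g x))"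
  unfolding recursive_def by (elim exE, rule_tac x = "Comp p pa" in exI) simp

text \<open>All programs are unary, so the step function is assumed recursive in uncurried form;
  \<open>x\<close> itself serves as the parameter that \<open>Prec\<close> carries along, and
  \<open>h x\<close> as the counter.\<close>

lemma recursive_rec_nat:
  assumes "recursive f"
    and "recursive (\<lambda>z. g (pi1 z) (pi1 (pi2 z)) (pi2 (pi2 z)))"
    and "recursive h"
  shows "recursive (\<lambda>x. rec_nat (f x) (g x) (h x))"
proof -
  obtain p q where p: "\<And>x. run p x = Some (f x)"
    and q: "\<And>z. run q z = Some (g (pi1 z) (pi1 (pi2 z)) (pi2 (pi2 z)))"
    using assms unfolding recursive_def by metis
  have "run (Prec p q) z = Some (rec_nat (f (pi1 z)) (g (pi1 z)) (pi2 z))" for z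
  proof -
    have "rec_nat (run p a)
        (\<lambda>y r. Option.bind r (\<lambda>v. run q (prod_encode (a, prod_encode (y, v))))) n
      = Some (rec_nat (f a) (g a) n)" for a n
      by (induction n) (simp_all add: p q)
    then show ?thesis by (simp add: prod_decode_pi)
  qed
  then have "recursive (\<lambda>z. rec_nat (f (pi1 z)) (g (pi1 z)) (pi2 z))"
    unfolding recursive_def by blast
  from recursive_compose [OF this recursive_prod_encode [OF recursive_id assms(3)]]
  show ?thesis by simp
qed

text \<open>A recursion of length 0 or 1 selects the branch: it starts from \<open>g x\<close>, and
  a single step overwrites this by \<open>f x\<close>.\<close>

lemma recursive_if:
  assumes "decidable P" "recursive f" "recursive g"
  shows "recursive (\<lambda>x. if P x then f x else g x)"
proof -
  have "(\<lambda>x. if P x then f x else g x)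
      = (\<lambda>x. rec_nat (g x) (\<lambda>y r. f x) (if P x then 1 else 0))"
    by auto
  moreover have "recursive \<dots>"
    by (intro recursive_rec_nat assms assms [unfolded decidable_def]
        recursive_compose [OF assms(2)] recursive_pi1 recursive_id)
  ultimately show ?thesis by simp
qed

section \<open>Closure properties of decidable predicates\<close>

lemma decidable_compose: "decidable P \<Longrightarrow> recursive f \<Longrightarrow> decidable (\<lambda>x. P (f x))"
  unfolding decidable_def by (rule recursive_compose)

lemma decidable_iff_if:
  assumes "decidable P" "decidable Q" "decidable R"
  shows "decidable (\<lambda>x. if P x then Q x else R x)"
proof -
  have "recursive (\<lambda>x. if P x then if Q x then 1 else 0 else if R x then 1 else 0)"
    using assms by (intro recursive_if recursive_const)
  moreover have "(\<lambda>x. if P x then if Q x then 1 else 0 else if R x then 1 else 0)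
      = (\<lambda>x. if if P x then Q x else R x then 1 else (0::nat))" by auto
  ultimately show ?thesis unfolding decidable_def by simp
qed

lemma decidable_const: "decidable (\<lambda>_. b)"
  unfolding decidable_def by (rule recursive_const)

lemma decidable_not: "decidable P \<Longrightarrow> decidable (\<lambda>x. \<not> P x)"
  by (rule back_subst [of decidable, OF decidable_iff_if [of P "\<lambda>_. False" "\<lambda>_. True"]])
    (auto intro: decidable_const)

lemma decidable_conj: "decidable P \<Longrightarrow> decidable Q \<Longrightarrow> decidable (\<lambda>x. P x \<and> Q x)"
  by (rule back_subst [of decidable, OF decidable_iff_if [of P Q "\<lambda>_. False"]])
    (auto intro: decidable_const)

lemma decidable_disj: "decidable P \<Longrightarrow> decidable Q \<Longrightarrow> decidable (\<lambda>x. P x \<or> Q x)"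
  by (rule back_subst [of decidable, OF decidable_iff_if [of P "\<lambda>_. True" Q]])
    (auto intro: decidable_const)

lemma decidable_imp: "decidable P \<Longrightarrow> decidable Q \<Longrightarrow> decidable (\<lambda>x. P x \<longrightarrow> Q x)"
  by (rule back_subst [of decidable, OF decidable_iff_if [of P Q "\<lambda>_. True"]])
    (auto intro: decidable_const)

lemma decidable_iff: "decidable P \<Longrightarrow> decidable Q \<Longrightarrow> decidable (\<lambda>x. P x \<longleftrightarrow> Q x)"
  by (rule back_subst [of decidable, OF decidable_iff_if [of P Q "\<lambda>x. \<not> Q x"]])
    (auto intro: decidable_not)

lemma decidable_bex:
  assumes "decidable (\<lambda>z. P (pi1 z) (pi2 z))" "recursive h"
  shows "decidable (\<lambda>x. \<exists>y<h x. P x y)"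
proof -
  have "rec_nat 0 (\<lambda>y r. if P x y then 1 else r) n = (if \<exists>y<n. P x y then 1 else (0::nat))" for x n
    by (induction n) (auto simp: less_Suc_eq)
  moreover have "recursive (\<lambda>x. rec_nat 0 (\<lambda>y r. if P x y then 1 else r) (h x))"
    \<comment> \<open>The step of the recursion receives the code of \<open>(x, (y, r))\<close>;
      this substitution drops \<open>r\<close>.\<close>
    using decidable_compose [OF assms(1),
        of "\<lambda>z. prod_encode (pi1 z, pi1 (pi2 z))"]
    by (intro recursive_rec_nat recursive_if recursive_const recursive_pi2 recursive_id assms)
       (simp add: recursive_prod_encode recursive_pi1 recursive_pi2 recursive_id)
  ultimately show ?thesis unfolding decidable_def by simp
qed

lemma decidable_ball:
  assumes "decidable (\<lambda>z. P (pi1 z) (pi2 z))" "recursive h"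
  shows "decidable (\<lambda>x. \<forall>y<h x. P x y)"
  using decidable_not [OF decidable_bex [of "\<lambda>x y. \<not> P x y", OF decidable_not [OF assms(1)] assms(2)]]
  by simp

lemma recursive_diff:
  assumes "recursive f" "recursive g"
  shows "recursive (\<lambda>x. f x - g x)"
proof -
  have pred: "recursive (\<lambda>x. f x - 1)" if "recursive f" for f
  proof -
    have "(\<lambda>x. f x - 1) = (\<lambda>x. rec_nat 0 (\<lambda>y r. y) (f x))"
    proof
      show "f x - 1 = rec_nat 0 (\<lambda>y r. y) (f x)" for x by (cases "f x") auto
    qed
    then show ?thesis
      using that by (auto intro!: recursive_rec_nat recursive_const recursive_pi1 recursive_pi2 recursive_id)
  qed
  have "rec_nat a (\<lambda>y r. r - 1) n = a - n" for a n :: nat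
    by (induction n) auto
  moreover have "recursive (\<lambda>x. rec_nat (f x) (\<lambda>y r. r - 1) (g x))"
    by (intro recursive_rec_nat pred recursive_pi2 recursive_id assms)
  ultimately show ?thesis by simp
qed

lemma decidable_le:
  assumes "recursive f" "recursive g"
  shows "decidable (\<lambda>x. f x \<le> g x)"
proof -
  have "rec_nat 1 (\<lambda>y r. 0) (f x - g x) = (if f x \<le> g x then 1 else (0::nat))" for x
    by (cases "f x - g x") auto
  moreover have "recursive (\<lambda>x. rec_nat 1 (\<lambda>y r. 0) (f x - g x))"
    by (intro recursive_rec_nat recursive_const recursive_diff assms)
  ultimately show ?thesis unfolding decidable_def by simp
qed

lemma decidable_less: "recursive f \<Longrightarrow> recursive g \<Longrightarrow> decidable (\<lambda>x. f x < g x)"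
  using decidable_le [OF recursive_Suc, of f g] by (simp add: Suc_le_eq)

lemma decidable_eq: "recursive f \<Longrightarrow> recursive g \<Longrightarrow> decidable (\<lambda>x. f x = g x)"
  using decidable_conj [OF decidable_le decidable_le, of f g g f] by (simp add: order_eq_iff)

section \<open>Unbounded search and c.e. sets\<close>

lemma run_Mu_decidable:
  assumes "decidable (\<lambda>z. P (pi1 z) (pi2 z))"
  obtains p where "\<And>x. run p x = (if \<exists>y. P x y then Some (LEAST y. P x y) else None)"
proof -
  obtain p where p: "\<And>z. run p z = Some (if P (pi1 z) (pi2 z) then 0 else 1)"
    using recursive_if [OF assms recursive_const recursive_const]
    unfolding recursive_def by blast
  have "run (Mu p) x = (if \<exists>y. P x y then Some (LEAST y. P x y) else None)" for x
    by (simp add: p Let_def)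
  then show ?thesis by (rule that)
qed

lemma recursive_Least:
  assumes "decidable (\<lambda>z. P (pi1 z) (pi2 z))" "\<And>x. \<exists>y. P x y"
  shows "recursive (\<lambda>x. LEAST y. P x y)"
proof -
  obtain p where "\<And>x. run p x = (if \<exists>y. P x y then Some (LEAST y. P x y) else None)"
    using run_Mu_decidable [of P, OF assms(1)] by blast
  with assms(2) show ?thesis unfolding recursive_def by auto
qed

definition ce :: "nat set \<Rightarrow> bool" where
  "ce V \<longleftrightarrow> (\<exists>p. V = {x. run p x \<noteq> None})"

lemma ce_ex:
  assumes "decidable (\<lambda>z. P (pi1 z) (pi2 z))"
  shows "ce {x. \<exists>y. P x y}"
proof -
  obtain p where "\<And>x. run p x = (if \<exists>y. P x y then Some (LEAST y. P x y) else None)"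
    using run_Mu_decidable [of P, OF assms(1)] by blast
  then have "{x. \<exists>y. P x y} = {x. run p x \<noteq> None}" by auto
  then show ?thesis unfolding ce_def by blast
qed

text \<open>Finite sequences are coded as nested pairs, and every number codes an infinite sequence.\<close>

definition seq :: "nat \<Rightarrow> nat \<Rightarrow> nat" where
  "seq c i = pi1 (rec_nat c (\<lambda>_. pi2) i)"

lemma recursive_seq: "recursive f \<Longrightarrow> recursive g \<Longrightarrow> recursive (\<lambda>x. seq (f x) (g x))"
  unfolding seq_def by (intro recursive_pi1 recursive_rec_nat recursive_pi2 recursive_id)

lemma seq_exists: "\<exists>c. \<forall>i<n. seq c i = f i"
proof (induction n arbitrary: f)
  case (Suc n)
  obtain c where c: "\<forall>i<n. seq c i = f (Suc i)" using Suc.IH [of "\<lambda>i. f (Suc i)"] ..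
  \<comment> \<open>\<open>rec_nat\<close> unfolds at the last application of \<open>pi2\<close>,
    whereas the shift concerns the first one; hence the induction.\<close>
  have "rec_nat (prod_encode (a, c)) (\<lambda>_. pi2) (Suc i) = rec_nat c (\<lambda>_. pi2) i" for a i
    by (induction i) auto
  then have "seq (prod_encode (f 0, c)) (Suc i) = seq c i" for i
    by (simp add: seq_def del: nat.rec)
  moreover have "seq (prod_encode (f 0, c)) 0 = f 0" by (simp add: seq_def)
  ultimately show ?case using c by (metis less_Suc_eq_0_disj)
qed simp

text \<open>With these rules \<open>intro\<close> proves decidability by following the syntax of a
  predicate. Predicates below are therefore phrased with projections and bounded
  quantifiers.\<close>

lemmas recursive_intros =
  recursive_id recursive_const recursive_Suc recursive_pi1 recursive_pi2 recursive_prod_encode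
  recursive_diff recursive_seq recursive_if
  decidable_not decidable_conj decidable_disj decidable_imp decidable_iff decidable_bex decidable_ball
  decidable_le decidable_less decidable_eq

section \<open>Derivations from decidable rules\<close>

inductive derivable :: "(nat \<Rightarrow> bool) \<Rightarrow> (nat \<Rightarrow> nat \<Rightarrow> nat \<Rightarrow> bool) \<Rightarrow> nat \<Rightarrow> bool"
  for J0 J2 where
  axiom: "J0 x \<Longrightarrow> derivable J0 J2 x"
| step: "derivable J0 J2 a \<Longrightarrow> derivable J0 J2 b \<Longrightarrow> J2 a b x \<Longrightarrow> derivable J0 J2 x"

text \<open>The linear form of a derivation tree: every entry is an axiom or follows from two
  earlier entries, so that validity is a bounded condition.\<close>

definition cert_list :: "(nat \<Rightarrow> bool) \<Rightarrow> (nat \<Rightarrow> nat \<Rightarrow> nat \<Rightarrow> bool) \<Rightarrow> nat \<Rightarrow> (nat \<Rightarrow> nat) \<Rightarrow> bool" where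
  "cert_list J0 J2 l c \<longleftrightarrow>
     (\<forall>n<l. J0 (c n) \<or> (\<exists>i<n. \<exists>j<n. J2 (c i) (c j) (c n)))"

definition cert :: "(nat \<Rightarrow> bool) \<Rightarrow> (nat \<Rightarrow> nat \<Rightarrow> nat \<Rightarrow> bool) \<Rightarrow> nat \<Rightarrow> nat \<Rightarrow> bool" where
  "cert J0 J2 x w \<longleftrightarrow> cert_list J0 J2 (pi1 w) (seq (pi2 w)) \<and> (\<exists>n<pi1 w. seq (pi2 w) n = x)"

text \<open>The parameter \<open>par\<close> lets axioms and rules vary with the input. Their
  decidability is assumed under arbitrary recursive substitutions, the form that
  \<open>recursive_intros\<close> produces as subgoals.\<close>

lemma decidable_cert:
  assumes "\<And>f g. recursive f \<Longrightarrow> recursive g \<Longrightarrow> decidable (\<lambda>x. J0 (f x) (g x))"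
    and "\<And>f g h k. recursive f \<Longrightarrow> recursive g \<Longrightarrow> recursive h \<Longrightarrow> recursive k \<Longrightarrow>
           decidable (\<lambda>x. J2 (f x) (g x) (h x) (k x))"
    and "recursive par" "recursive f" "recursive w"
  shows "decidable (\<lambda>x. cert (J0 (par x)) (J2 (par x)) (f x) (w x))"
  unfolding cert_def cert_list_def
  by (intro recursive_intros assms recursive_compose [OF assms(3)]
      recursive_compose [OF assms(4)] recursive_compose [OF assms(5)])

lemma cert_list_append:
  assumes "cert_list J0 J2 l c" "cert_list J0 J2 m d"
  shows "cert_list J0 J2 (l + m) (\<lambda>n. if n < l then c n else d (n - l))"
  unfolding cert_list_def
proof (intro allI impI)
  fix n assume n: "n < l + m"
  let ?e = "\<lambda>n. if n < l then c n else d (n - l)"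
  show "J0 (?e n) \<or> (\<exists>i<n. \<exists>j<n. J2 (?e i) (?e j) (?e n))"
  proof (cases "n < l")
    case True
    then show ?thesis using assms(1) unfolding cert_list_def by (smt (verit) order.strict_trans)
  next
    case False
    then obtain k where k: "n = l + k" "k < m" using n by (metis add_less_cancel_left le_Suc_ex not_less)
    with assms(2) consider "J0 (d k)" | i j where "i < k" "j < k" "J2 (d i) (d j) (d k)"
      unfolding cert_list_def by blast
    then show ?thesis
    proof cases
      case 1 then show ?thesis using k by simp
    next
      case 2
      then have "J2 (?e (l + i)) (?e (l + j)) (?e n)" "l + i < n" "l + j < n" using k by simp_all
      then show ?thesis by blast
    qed
  qed
qed

text \<open>From left to right, the lists for the two premises are concatenated and the conclusion
  is appended. From right to left, strong induction on the position in the list.\<close>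

lemma derivable_iff_cert: "derivable J0 J2 x \<longleftrightarrow> (\<exists>w. cert J0 J2 x w)"
proof
  assume "derivable J0 J2 x"
  then have "\<exists>l c. cert_list J0 J2 l c \<and> (\<exists>n<l. c n = x)"
  proof induction
    case (axiom x)
    then show ?case by (intro exI [of _ 1] exI [of _ "\<lambda>_. x"]) (simp add: cert_list_def)
  next
    case (step a b x)
    then obtain l c m d i j where lc: "cert_list J0 J2 l c" "i < l" "c i = a"
      and md: "cert_list J0 J2 m d" "j < m" "d j = b" by blast
    define e where "e = (\<lambda>n. if n < l then c n else d (n - l))"
    have e: "cert_list J0 J2 (l + m) e" unfolding e_def by (rule cert_list_append [OF lc(1) md(1)])
    have "e i = a" "e (l + j) = b" using lc md by (auto simp: e_def)
    then have ab: "i < l + m" "l + j < l + m" "J2 (e i) (e (l + j)) x"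
      using lc md step.hyps(3) by simp_all
    have "cert_list J0 J2 (Suc (l + m)) (e(l + m := x))"
      unfolding cert_list_def
    proof (intro allI impI)
      fix n assume "n < Suc (l + m)"
      then consider "n < l + m" | "n = l + m" by linarith
      then show "J0 ((e(l + m := x)) n) \<or> (\<exists>i<n. \<exists>j<n.
        J2 ((e(l + m := x)) i) ((e(l + m := x)) j) ((e(l + m := x)) n))"
      proof cases
        case 1
        then have "J0 (e n) \<or> (\<exists>i<n. \<exists>j<n. J2 (e i) (e j) (e n))"
          using e unfolding cert_list_def by blast
        with 1 show ?thesis by fastforce
      next
        case 2
        with ab show ?thesis
          by (intro disjI2 exI [of _ i] exI [of _ "l + j"] conjI) simp_all
      qed
    qed
    then show ?case by (metis fun_upd_same lessI)
  qed
  then obtain l c n where lc: "cert_list J0 J2 l c" "n < l" "c n = x" by blast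
  obtain s where s: "\<forall>i<l. seq s i = c i" using seq_exists by blast
  have "cert_list J0 J2 l (seq s)"
    using lc(1) s unfolding cert_list_def by (metis order.strict_trans)
  then have "cert J0 J2 x (prod_encode (l, s))" using lc s by (auto simp: cert_def)
  then show "\<exists>w. cert J0 J2 x w" by blast
next
  assume "\<exists>w. cert J0 J2 x w"
  then obtain l c n where c: "cert_list J0 J2 l c" and n: "n < l" "c n = x"
    unfolding cert_def by blast
  have "k < l \<Longrightarrow> derivable J0 J2 (c k)" for k
  proof (induction k rule: less_induct)
    case (less k)
    then consider "J0 (c k)" | i j where "i < k" "j < k" "J2 (c i) (c j) (c k)"
      using c unfolding cert_list_def by blast
    then show ?case
    proof cases
      case 1
      then show ?thesis by (rule derivable.axiom)
    next
      case 2
      then show ?thesis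
        using derivable.step [of J0 J2 "c i" "c j" "c k"] less by simp
    qed
  qed
  with n show "derivable J0 J2 x" by blast
qed

section \<open>A universal halting predicate\<close>

lemma run_Prec_0: "run (Prec p q) (prod_encode (a, 0)) = run p a"
  by simp

lemma run_Prec_Suc: "run (Prec p q) (prod_encode (a, Suc n)) =
    Option.bind (run (Prec p q) (prod_encode (a, n)))
      (\<lambda>v. run q (prod_encode (a, prod_encode (n, v))))"
  by simp

text \<open>Judgements are triples of a program code, an argument and a value. The tag 8, which no program
  code carries, marks the partial search of \<^const>\<open>Mu\<close>: the value \<open>y\<close> then means that the program
  returns a nonzero value at each of the first \<open>y\<close> candidates. This keeps all rules binary.\<close>

definition eval_axiom :: "nat \<Rightarrow> nat \<Rightarrow> nat \<Rightarrow> bool" where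
  "eval_axiom e x y \<longleftrightarrow>
     e = prod_encode (0, 0) \<and> y = 0 \<or>
     e = prod_encode (1, 0) \<and> y = Suc x \<or>
     e = prod_encode (2, 0) \<and> y = pi1 x \<or>
     e = prod_encode (3, 0) \<and> y = pi2 x \<or>
     pi1 e = 8 \<and> y = 0"

text \<open>In order: pairing, composition, base and step of primitive recursion, one more failed
  candidate of a search, and its success. The base rule looks at the first premise only, so the same
  judgement can be supplied for both.\<close>

definition eval_rule :: "nat \<Rightarrow> nat \<Rightarrow> nat \<Rightarrow> nat \<Rightarrow> nat \<Rightarrow> nat \<Rightarrow> nat \<Rightarrow> nat \<Rightarrow> nat \<Rightarrow> bool" where
  "eval_rule e1 x1 y1 e2 x2 y2 e x y \<longleftrightarrow>
     e = prod_encode (4, prod_encode (e1, e2)) \<and> x1 = x \<and> x2 = x \<and> y = prod_encode (y1, y2) \<or>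
     e = prod_encode (5, prod_encode (e2, e1)) \<and> x1 = x \<and> x2 = y1 \<and> y = y2 \<or>
     pi1 e = 6 \<and> e1 = pi1 (pi2 e) \<and> x = prod_encode (x1, 0) \<and> y = y1 \<or>
     pi1 e = 6 \<and> e1 = e \<and> e2 = pi2 (pi2 e) \<and> x = prod_encode (pi1 x1, Suc (pi2 x1)) \<and>
       x2 = prod_encode (pi1 x1, prod_encode (pi2 x1, y1)) \<and> y = y2 \<or>
     e1 = prod_encode (8, e2) \<and> x1 = x \<and> x2 = prod_encode (x, y1) \<and> 0 < y2 \<and> e = e1 \<and> y = Suc y1 \<or>
     e1 = prod_encode (8, e2) \<and> x1 = x \<and> x2 = prod_encode (x, y1) \<and> y2 = 0 \<and>
       e = prod_encode (7, e2) \<and> y = y1"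

abbreviation coded_axiom :: "nat \<Rightarrow> bool" where
  "coded_axiom z \<equiv> eval_axiom (pi1 z) (pi1 (pi2 z)) (pi2 (pi2 z))"

abbreviation coded_rule :: "nat \<Rightarrow> nat \<Rightarrow> nat \<Rightarrow> bool" where
  "coded_rule a b z \<equiv> eval_rule (pi1 a) (pi1 (pi2 a)) (pi2 (pi2 a))
     (pi1 b) (pi1 (pi2 b)) (pi2 (pi2 b)) (pi1 z) (pi1 (pi2 z)) (pi2 (pi2 z))"

abbreviation evals :: "nat \<Rightarrow> bool" where
  "evals \<equiv> derivable coded_axiom coded_rule"

abbreviation triple :: "nat \<Rightarrow> nat \<Rightarrow> nat \<Rightarrow> nat" where
  "triple a b c \<equiv> prod_encode (a, prod_encode (b, c))"

lemma evals_axiom: "eval_axiom e x y \<Longrightarrow> evals (triple e x y)"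
  by (rule derivable.axiom) simp

lemma evals_rule:
  "evals (triple e1 x1 y1) \<Longrightarrow> evals (triple e2 x2 y2) \<Longrightarrow>
   eval_rule e1 x1 y1 e2 x2 y2 e x y \<Longrightarrow> evals (triple e x y)"
  by (erule (1) derivable.step) simp

lemma prog_code_eq_iff:
  "prod_encode (0, 0) = prog_code p \<longleftrightarrow> p = Zero"
  "prod_encode (1, 0) = prog_code p \<longleftrightarrow> p = Succ"
  "prod_encode (2, 0) = prog_code p \<longleftrightarrow> p = Fst"
  "prod_encode (3, 0) = prog_code p \<longleftrightarrow> p = Snd"
  "prod_encode (4, prod_encode (e1, e2)) = prog_code p \<longleftrightarrow>
     (\<exists>q r. p = Pair q r \<and> e1 = prog_code q \<and> e2 = prog_code r)"
  "prod_encode (5, prod_encode (e1, e2)) = prog_code p \<longleftrightarrow>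
     (\<exists>q r. p = Comp q r \<and> e1 = prog_code q \<and> e2 = prog_code r)"
  "prod_encode (7, e1) = prog_code p \<longleftrightarrow> (\<exists>q. p = Mu q \<and> e1 = prog_code q)"
  "pi1 (prog_code p) = 6 \<longleftrightarrow> (\<exists>q r. p = Prec q r)"
  "pi1 (prog_code p) = 8 \<longleftrightarrow> False"
  by (cases p; auto)+

text \<open>The two claims need each other: the rules for \<open>Mu\<close> combine a search
  judgement with an evaluation judgement. The second claim is the meaning of the tag 8.\<close>

lemma evals_sound:
  "evals z \<Longrightarrow>
    (\<forall>p. pi1 z = prog_code p \<longrightarrow> run p (pi1 (pi2 z)) = Some (pi2 (pi2 z))) \<and>
    (\<forall>p. pi1 z = prod_encode (8, prog_code p) \<longrightarrow>
       (\<forall>j<pi2 (pi2 z). \<exists>v. run p (prod_encode (pi1 (pi2 z), j)) = Some (Suc v)))"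
proof (induction rule: derivable.induct)
  case (axiom z)
  have "run p (pi1 (pi2 z)) = Some (pi2 (pi2 z))" if "pi1 z = prog_code p" for p
    using axiom that
    by (cases p) (auto simp: eval_axiom_def pi1_def [symmetric] pi2_def [symmetric])
  moreover have "pi2 (pi2 z) = 0" if "pi1 z = prod_encode (8, e)" for e
    using axiom that by (auto simp: eval_axiom_def)
  ultimately show ?case by auto
next
  case (step a b z)
  define e1 x1 y1 e2 x2 y2 e x y where defs: "e1 = pi1 a" "x1 = pi1 (pi2 a)" "y1 = pi2 (pi2 a)"
    "e2 = pi1 b" "x2 = pi1 (pi2 b)" "y2 = pi2 (pi2 b)"
    "e = pi1 z" "x = pi1 (pi2 z)" "y = pi2 (pi2 z)"
  note IH = step.IH [folded defs] and rule = step.hyps(3) [folded defs]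
  have 1: "run p x1 = Some y1" if "e1 = prog_code p" for p using IH that by blast
  have 2: "run p x2 = Some y2" if "e2 = prog_code p" for p using IH that by blast
  have 3: "\<exists>v. run p (prod_encode (x1, j)) = Some (Suc v)"
    if "e1 = prod_encode (8, prog_code p)" "j < y1" for p j using IH that by blast
  have "(\<forall>p. e = prog_code p \<longrightarrow> run p x = Some y) \<and>
    (\<forall>p. e = prod_encode (8, prog_code p) \<longrightarrow>
       (\<forall>j<y. \<exists>v. run p (prod_encode (x, j)) = Some (Suc v)))"
    using rule [unfolded eval_rule_def]
  proof (elim disjE conjE)
    assume "e = prod_encode (4, prod_encode (e1, e2))" "x1 = x" "x2 = x" "y = prod_encode (y1, y2)"
    then show ?thesis using 1 2 by (auto simp: prog_code_eq_iff)
  next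
    assume "e = prod_encode (5, prod_encode (e2, e1))" "x1 = x" "x2 = y1" "y = y2"
    then show ?thesis using 1 2 by (auto simp: prog_code_eq_iff)
  next
    assume *: "pi1 e = 6" "e1 = pi1 (pi2 e)" "x = prod_encode (x1, 0)" "y = y1"
    have "run p x = Some y" if "e = prog_code p" for p
    proof -
      obtain q r where "p = Prec q r" "e1 = prog_code q"
        using * \<open>e = prog_code p\<close> by (cases p) auto
      then show ?thesis using * 1 by (simp only: run_Prec_0)
    qed
    then show ?thesis using * by auto
  next
    assume *: "pi1 e = 6" "e1 = e" "e2 = pi2 (pi2 e)" "x = prod_encode (pi1 x1, Suc (pi2 x1))"
      "x2 = prod_encode (pi1 x1, prod_encode (pi2 x1, y1))" "y = y2"
    have "run p x = Some y" if "e = prog_code p" for p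
    proof -
      obtain q r where "p = Prec q r" "e2 = prog_code r"
        using * \<open>e = prog_code p\<close> by (cases p) auto
      then show ?thesis using * 1 [of p] 2 [of r] that
        by (simp del: run.simps add: run_Prec_Suc)
    qed
    then show ?thesis using * by auto
  next
    assume "e1 = prod_encode (8, e2)" "x1 = x" "x2 = prod_encode (x, y1)" "0 < y2" "e = e1" "y = Suc y1"
    then show ?thesis using 2 3 prog_code_eq_iff(9)
      by (auto simp: less_Suc_eq gr0_conv_Suc) (metis pi_prod_encode(1))
  next
    assume *: "e1 = prod_encode (8, e2)" "x1 = x" "x2 = prod_encode (x, y1)" "y2 = 0"
      "e = prod_encode (7, e2)" "y = y1"
    have "run (Mu q) x = Some y" if "e2 = prog_code q" for q
    proof -
      have a: "run q (prod_encode (x, y)) = Some 0" using 2 that * by auto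
      have b: "\<exists>v. run q (prod_encode (x, j)) = Some (Suc v)" if "j < y" for j
        using 3 \<open>e2 = prog_code q\<close> that * by auto
      let ?P = "\<lambda>m. run q (prod_encode (x, m)) = Some 0 \<and>
        (\<forall>j<m. run q (prod_encode (x, j)) \<noteq> None)"
      have P: "?P y" using a b by fastforce
      moreover have "(LEAST m. ?P m) = y"
      proof (rule Least_equality)
        show "?P y" by (rule P)
        show "y \<le> m" if "?P m" for m
          using b [of m] that by (cases "m < y") auto
      qed
      ultimately show ?thesis by (auto simp: Let_def)
    qed
    then show ?thesis using * by (auto simp: prog_code_eq_iff simp del: run.simps)
  qed
  then show ?case unfolding defs .
qed

text \<open>Structural induction on the program, with an inner induction on the counter for
  \<open>Prec\<close> and on the number of refuted candidates for \<open>Mu\<close>.\<close>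

lemma evals_complete: "run p x = Some y \<Longrightarrow> evals (triple (prog_code p) x y)"
proof (induction p arbitrary: x y)
  case (Pair p q)
  then obtain a b where "run p x = Some a" "run q x = Some b" "y = prod_encode (a, b)"
    by (auto simp: bind_eq_Some_conv)
  with evals_rule [OF Pair.IH] show ?case by (simp add: eval_rule_def)
next
  case (Comp p q)
  then obtain a where "run q x = Some a" "run p a = Some y"
    by (auto simp: bind_eq_Some_conv)
  with evals_rule [OF Comp.IH(2,1)] show ?case by (simp add: eval_rule_def)
next
  case (Prec p q)
  have "run (Prec p q) (prod_encode (a, n)) = Some y \<Longrightarrow>
    evals (triple (prog_code (Prec p q)) (prod_encode (a, n)) y)" for a n
  proof (induction n arbitrary: y)
    case 0
    then have "evals (triple (prog_code p) a y)" using Prec.IH(1) by (simp only: run_Prec_0)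
    from this this show ?case by (rule evals_rule) (simp add: eval_rule_def)
  next
    case (Suc n)
    then obtain v where v: "run (Prec p q) (prod_encode (a, n)) = Some v"
      "run q (prod_encode (a, prod_encode (n, v))) = Some y"
      by (auto simp only: run_Prec_Suc bind_eq_Some_conv)
    from Suc.IH [OF v(1)] Prec.IH(2) [OF v(2)] show ?case
      by (rule evals_rule) (simp add: eval_rule_def)
  qed
  from this [of "pi1 x" "pi2 x"] show ?case using Prec.prems by (simp del: run.simps)
next
  case (Mu p)
  let ?P = "\<lambda>m. run p (prod_encode (x, m)) = Some 0 \<and>
    (\<forall>j<m. run p (prod_encode (x, j)) \<noteq> None)"
  have ex: "\<exists>m. ?P m" and y: "y = (LEAST m. ?P m)"
    using Mu.prems by (auto simp: Let_def split: if_splits)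
  have P: "?P y" unfolding y by (rule LeastI_ex [OF ex])
  have nz: "\<exists>v. run p (prod_encode (x, j)) = Some (Suc v)" if j: "j < y" for j
  proof -
    obtain w where w: "run p (prod_encode (x, j)) = Some w" using P j by auto
    \<comment> \<open>The program is defined at all candidates up to \<open>j\<close>, so a value 0
      at \<open>j\<close> would contradict the minimality of \<open>y\<close>.\<close>
    have "\<not> ?P j" using not_less_Least j unfolding y by blast
    with w P j have "w \<noteq> 0" by auto
    with w show ?thesis by (cases w) auto
  qed
  have "j \<le> y \<Longrightarrow> evals (triple (prod_encode (8, prog_code p)) x j)" for j
  proof (induction j)
    case 0
    show ?case by (rule evals_axiom) (simp add: eval_axiom_def)
  next
    case (Suc j)
    then obtain v where "run p (prod_encode (x, j)) = Some (Suc v)" using nz [of j] by auto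
    from evals_rule [OF Suc.IH Mu.IH [OF this]] Suc.prems show ?case
      by (simp add: eval_rule_def)
  qed
  from evals_rule [OF this [of y] Mu.IH [OF P [THEN conjunct1]]] show ?case
    by (simp add: eval_rule_def)
qed (rule evals_axiom, force simp: eval_axiom_def pi1_def [symmetric] pi2_def [symmetric])+

text \<open>Kleene's T predicate: \<open>w\<close> pairs the output with a certificate that the
  computation yields it.\<close>

definition halting_witness :: "nat \<Rightarrow> nat \<Rightarrow> nat \<Rightarrow> bool" where
  "halting_witness e x w \<longleftrightarrow>
     cert coded_axiom coded_rule (triple e x (pi1 w)) (pi2 w)"

lemma halts_iff_witness: "run p x \<noteq> None \<longleftrightarrow> (\<exists>w. halting_witness (prog_code p) x w)"
proof -
  have "run p x = Some y \<longleftrightarrow> evals (triple (prog_code p) x y)" for y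
    using evals_complete evals_sound by fastforce
  then have "run p x \<noteq> None \<longleftrightarrow> (\<exists>y. evals (triple (prog_code p) x y))" by auto
  also have "\<dots> \<longleftrightarrow> (\<exists>y w. halting_witness (prog_code p) x (prod_encode (y, w)))"
    by (simp add: derivable_iff_cert halting_witness_def)
  also have "\<dots> \<longleftrightarrow> (\<exists>w. halting_witness (prog_code p) x w)"
    by (metis prod_encode_pi)
  finally show ?thesis .
qed

lemma decidable_halting_witness:
  assumes "recursive f" "recursive g" "recursive h"
  shows "decidable (\<lambda>x. halting_witness (f x) (g x) (h x))"
proof -
  have "decidable (\<lambda>x. coded_axiom (f x))" if "recursive f" for f
    unfolding eval_axiom_def by (intro recursive_intros that)
  moreover have "decidable (\<lambda>x. coded_rule (f x) (g x) (h x))"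
    if "recursive f" "recursive g" "recursive h" for f g h
    unfolding eval_rule_def by (intro recursive_intros that)
  ultimately show ?thesis
    unfolding halting_witness_def
    using decidable_cert [of "\<lambda>_. coded_axiom" "\<lambda>_. coded_rule" "\<lambda>_. 0"
        "\<lambda>x. triple (f x) (g x) (pi1 (h x))" "\<lambda>x. pi2 (h x)"]
    by (simp add: assms recursive_intros)
qed

section \<open>A computable sequence with a generic limit\<close>

text \<open>A finite binary string is coded by its length paired with a sequence code.\<close>

definition bit_at :: "nat \<Rightarrow> nat \<Rightarrow> bool" where
  "bit_at q i \<longleftrightarrow> seq (pi2 q) i \<noteq> 0"

definition extends :: "nat \<Rightarrow> nat \<Rightarrow> bool" where
  "extends q c \<longleftrightarrow> pi1 c \<le> pi1 q \<and> (\<forall>i<pi1 c. bit_at q i \<longleftrightarrow> bit_at c i)"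

definition initial :: "nat \<Rightarrow> (nat \<Rightarrow> bool) \<Rightarrow> bool" where
  "initial q X \<longleftrightarrow> (\<forall>i<pi1 q. bit_at q i \<longleftrightarrow> X i)"

lemma initial_exists: "\<exists>q. pi1 q = n \<and> initial q X"
proof -
  obtain c where "\<forall>i<n. seq c i = (if X i then 1 else 0)"
    using seq_exists [of n "\<lambda>i. if X i then 1 else 0"] ..
  then have "initial (prod_encode (n, c)) X" by (simp add: initial_def bit_at_def)
  then show ?thesis by (metis pi_prod_encode(1))
qed

lemma extends_trans: "extends r q \<Longrightarrow> extends q c \<Longrightarrow> extends r c"
  unfolding extends_def by (metis order.strict_trans2 order.trans)

text \<open>The disjunct \<open>s \<le> q\<close> makes the search for \<open>q\<close> total; such a \<open>q\<close> signals failure.\<close>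

definition enters :: "nat \<Rightarrow> nat \<Rightarrow> nat \<Rightarrow> nat \<Rightarrow> bool" where
  "enters s e c q \<longleftrightarrow> s \<le> q \<or> extends q c \<and> (\<exists>w<s. halting_witness e q w)"

text \<open>The attempt at stage \<open>s\<close> to meet the requirement \<open>e\<close>: move to
  the least extension of \<open>c\<close> already seen to enter the c.e. set with index
  \<open>e\<close>, or stay at \<open>c\<close>.\<close>

definition extend_into :: "nat \<Rightarrow> nat \<Rightarrow> nat \<Rightarrow> nat" where
  "extend_into s e c = (if (LEAST q. enters s e c q) < s then LEAST q. enters s e c q else c)"

text \<open>The guess at stage \<open>s\<close> for the string that meets the first \<open>e\<close>
  requirements, recomputed at each stage from the code 0 of the empty string.\<close>

definition approx :: "nat \<Rightarrow> nat \<Rightarrow> nat" where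
  "approx s = rec_nat 0 (extend_into s)"

lemma approx_Suc [simp]: "approx s (Suc e) = extend_into s e (approx s e)"
  by (simp add: approx_def)

lemma recursive_extend_into:
  assumes "recursive f" "recursive g" "recursive h"
  shows "recursive (\<lambda>x. extend_into (f x) (g x) (h x))"
proof -
  have "recursive (\<lambda>x. LEAST q. enters (f x) (g x) (h x) q)"
  proof (rule recursive_Least)
    show "decidable (\<lambda>z. enters (f (pi1 z)) (g (pi1 z)) (h (pi1 z)) (pi2 z))"
      unfolding enters_def extends_def bit_at_def
      by (intro recursive_intros decidable_halting_witness
          recursive_compose [OF assms(1)] recursive_compose [OF assms(2)]
          recursive_compose [OF assms(3)])
    show "\<exists>q. enters (f x) (g x) (h x) q" for x
      unfolding enters_def by blast
  qed
  then show ?thesis unfolding extend_into_def by (intro recursive_intros assms)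
qed

lemma recursive_approx:
  assumes "recursive f" "recursive g"
  shows "recursive (\<lambda>x. approx (f x) (g x))"
  unfolding approx_def
  by (intro recursive_rec_nat recursive_extend_into recursive_intros assms
      recursive_compose [OF assms(1)])

lemma extends_extend_into: "extends (extend_into s e c) c"
proof -
  have "enters s e c (LEAST q. enters s e c q)"
    by (rule LeastI [of _ s]) (simp add: enters_def)
  then have "(LEAST q. enters s e c q) < s \<Longrightarrow> extends (LEAST q. enters s e c q) c"
    by (subst (asm) enters_def) auto
  then show ?thesis by (simp add: extend_into_def) (simp add: extends_def)
qed

text \<open>If \<open>q\<close> is the least extension of \<open>c\<close> with a halting witness
  \<open>w\<close>, then it is found at every stage beyond both \<open>q\<close> and
  \<open>w\<close>. If there is no such extension, the string never moves and the set is avoided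
  above \<open>c\<close>.\<close>

lemma extend_into_limit:
  "\<exists>c'. (\<exists>N. \<forall>s\<ge>N. extend_into s e c = c') \<and> extends c' c \<and>
     ((\<exists>w. halting_witness e c' w) \<or> (\<forall>q. extends q c \<longrightarrow> \<not> (\<exists>w. halting_witness e q w)))"
proof (cases "\<exists>q. extends q c \<and> (\<exists>w. halting_witness e q w)")
  case True
  let ?P = "\<lambda>q. extends q c \<and> (\<exists>w. halting_witness e q w)"
  define q where "q = (LEAST q. ?P q)"
  have P: "?P q" unfolding q_def using LeastI_ex [OF True] .
  then obtain w where w: "halting_witness e q w" by blast
  have "extend_into s e c = q" if "s \<ge> Suc (max q w)" for s
  proof -
    have "(LEAST q. enters s e c q) = q"
    proof (rule Least_equality)
      show "enters s e c q" using P w that by (auto simp: enters_def)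
      show "q \<le> r" if "enters s e c r" for r
        using that \<open>s \<ge> Suc (max q w)\<close> Least_le [of ?P r] unfolding enters_def q_def by fastforce
    qed
    then show ?thesis using that by (auto simp: extend_into_def)
  qed
  then show ?thesis using P by blast
next
  case False
  have "(LEAST q. enters s e c q) = s" for s
    using False by (intro Least_equality) (auto simp: enters_def)
  then have "extend_into s e c = c" for s
    by (simp add: extend_into_def)
  moreover have "extends c c" by (simp add: extends_def)
  ultimately show ?thesis using False by blast
qed

text \<open>Induction on \<open>e\<close>: once the guess at level \<open>e\<close> has settled, the
  next level is \<open>extend_into\<close> applied to a fixed string, which settles by the preceding
  lemma.\<close>

lemma approx_limit:
  "\<exists>c. \<forall>e. (\<exists>N. \<forall>s\<ge>N. approx s e = c e) \<and> extends (c (Suc e)) (c e) \<and>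
     ((\<exists>w. halting_witness e (c (Suc e)) w) \<or>
       (\<forall>q. extends q (c e) \<longrightarrow> \<not> (\<exists>w. halting_witness e q w)))"
proof -
  obtain F where F: "\<And>e c. \<exists>N. \<forall>s\<ge>N. extend_into s e c = F e c" "\<And>e c. extends (F e c) c"
    "\<And>e c. (\<exists>w. halting_witness e (F e c) w) \<or>
       (\<forall>q. extends q c \<longrightarrow> \<not> (\<exists>w. halting_witness e q w))"
    using extend_into_limit by metis
  define c where "c = rec_nat 0 F"
  have [simp]: "c (Suc e) = F e (c e)" for e by (simp add: c_def)
  have "\<exists>N. \<forall>s\<ge>N. approx s e = c e" for e
  proof (induction e)
    case 0
    show ?case by (simp add: approx_def c_def)
  next
    case (Suc e)
    then obtain N where "\<forall>s\<ge>N. approx s e = c e" ..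
    moreover obtain M where "\<forall>s\<ge>M. extend_into s e (c e) = F e (c e)" using F(1) by blast
    ultimately have "\<forall>s\<ge>max N M. approx s (Suc e) = c (Suc e)" by simp
    then show ?case ..
  qed
  then show ?thesis using F by (intro exI [of _ c]) simp
qed

text \<open>\<open>b\<close> is the union of the limit strings \<open>c e\<close>.
  \<open>T s\<close> is the guess for \<open>b\<close> at stage \<open>s\<close>, cut off at
  \<open>s\<close> and with \<open>s\<close> added as its maximum. The last property is
  1-genericity: a c.e. set of strings contains an initial segment of \<open>b\<close> or is avoided
  above one.\<close>

lemma generic_sequence:
  obtains T b where
    "\<And>f g. recursive f \<Longrightarrow> recursive g \<Longrightarrow> decidable (\<lambda>x. T (f x) (g x))"
    "\<And>s. T s s" "\<And>s r. s < r \<Longrightarrow> \<not> T s r"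
    "\<And>r. \<exists>N. \<forall>s\<ge>N. T s r \<longleftrightarrow> b r" "\<And>n. \<exists>r\<ge>n. b r"
    "\<And>V. ce V \<Longrightarrow> (\<exists>q\<in>V. initial q b) \<or>
       (\<exists>n. \<forall>q\<in>V. n \<le> pi1 q \<longrightarrow> \<not> (\<forall>i<n. bit_at q i \<longleftrightarrow> b i))"
proof -
  obtain c where lim: "\<And>e. \<exists>N. \<forall>s\<ge>N. approx s e = c e"
    and ext_Suc: "\<And>e. extends (c (Suc e)) (c e)"
    and gen: "\<And>e. (\<exists>w. halting_witness e (c (Suc e)) w) \<or>
       (\<forall>q. extends q (c e) \<longrightarrow> \<not> (\<exists>w. halting_witness e q w))"
    using approx_limit by metis
  have ext: "extends (c e') (c e)" if "e \<le> e'" for e e'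
    using that
  proof (induction e' rule: dec_induct)
    case base
    show ?case by (simp add: extends_def)
  next
    case (step n)
    with ext_Suc show ?case by (metis extends_trans)
  qed
  have approx_ext: "extends (approx s e') (approx s e)" if "e \<le> e'" for s e e'
    using that
  proof (induction e' rule: dec_induct)
    case base
    show ?case by (simp add: extends_def)
  next
    case (step n)
    have "extends (approx s (Suc n)) (approx s n)" by (simp add: extends_extend_into)
    with step show ?case by (metis extends_trans)
  qed
  define b where "b r \<longleftrightarrow> (\<exists>e. r < pi1 (c e) \<and> bit_at (c e) r)" for r
  have init: "initial (c e) b" for e
  proof -
    have "bit_at (c e) i" if "i < pi1 (c e)" "i < pi1 (c e')" "bit_at (c e') i" for i e'
      using ext [of e e'] ext [of e' e] that by (cases "e \<le> e'") (auto simp: extends_def)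
    then show ?thesis by (auto simp: initial_def b_def)
  qed
  have gen': "(\<exists>e. c e \<in> V) \<or> (\<exists>e. \<forall>q\<in>V. \<not> extends q (c e))" if V: "ce V" for V
  proof -
    obtain p where "V = {x. run p x \<noteq> None}" using V unfolding ce_def by blast
    then have "V = {x. \<exists>w. halting_witness (prog_code p) x w}" by (simp only: halts_iff_witness)
    \<comment> \<open>The requirement whose number is the code of \<open>p\<close> takes care of
      \<open>V\<close>.\<close>
    with gen [of "prog_code p"] show ?thesis by blast
  qed
  have inf: "\<exists>e. \<exists>i<pi1 (c e). n \<le> i \<and> bit_at (c e) i" for n
  proof -
    \<comment> \<open>The strings with a 1 at or beyond \<open>n\<close> form a dense c.e. set, so
      genericity alone makes \<open>b\<close> infinite and the lengths of the strings
      \<open>c e\<close> unbounded.\<close>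
    let ?V = "{q. \<exists>i. i < pi1 q \<and> n \<le> i \<and> bit_at q i}"
    have "ce ?V"
      unfolding bit_at_def by (intro ce_ex recursive_intros)
    moreover have "\<exists>q\<in>?V. extends q (c e)" for e
    proof -
      \<comment> \<open>\<open>q\<close> prolongs \<open>c e\<close> by ones up to and including
        position \<open>max n (pi1 (c e))\<close>.\<close>
      obtain q where q: "pi1 q = Suc (max n (pi1 (c e)))"
        "initial q (\<lambda>i. i < pi1 (c e) \<longrightarrow> bit_at (c e) i)"
        using initial_exists by blast
      then have "extends q (c e)" by (auto simp: extends_def initial_def)
      moreover have "max n (pi1 (c e)) < pi1 q" "bit_at q (max n (pi1 (c e)))"
        using q by (auto simp: initial_def)
      then have "q \<in> ?V" by (metis (mono_tags, lifting) max.cobounded1 mem_Collect_eq)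
      ultimately show ?thesis by blast
    qed
    ultimately show ?thesis using gen' [of ?V] by blast
  qed
  \<comment> \<open>A position \<open>r\<close> may lie beyond the length of
    \<open>approx s s\<close>, where \<open>bit_at\<close> is arbitrary; the limit is unaffected,
    since the lengths of the guesses eventually exceed each \<open>r\<close>.\<close>
  define T where "T s r \<longleftrightarrow> r = s \<or> r < s \<and> bit_at (approx s s) r" for s r
  show thesis
  proof (rule that [of T b])
    show "decidable (\<lambda>x. T (f x) (g x))" if "recursive f" "recursive g" for f g
      unfolding T_def bit_at_def by (intro recursive_intros recursive_approx that)
    show "T s s" for s by (simp add: T_def)
    show "\<not> T s r" if "s < r" for s r using that by (simp add: T_def)
    show "\<exists>r\<ge>n. b r" for n using inf [of n] unfolding b_def by blast
    show "\<exists>N. \<forall>s\<ge>N. T s r \<longleftrightarrow> b r" for r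
    proof -
      obtain e where e: "r < pi1 (c e)" using inf [of r] by (metis order.strict_trans1)
      obtain N where N: "\<forall>s\<ge>N. approx s e = c e" using lim by blast
      \<comment> \<open>\<open>N\<close> settles level \<open>e\<close>, \<open>e \<le> s\<close>
        makes \<open>approx s s\<close> extend that level, and \<open>r < s\<close> selects the
        second disjunct of \<open>T\<close>.\<close>
      have "T s r \<longleftrightarrow> b r" if s: "s \<ge> max N (max e (Suc r))" for s
      proof -
        have "extends (approx s s) (c e)" using approx_ext [of e s s] N s by auto
        then have "bit_at (approx s s) r \<longleftrightarrow> b r"
          using e init [of e] by (simp add: extends_def initial_def)
        then show ?thesis using s by (auto simp: T_def)
      qed
      then show ?thesis by blast
    qed
    show "(\<exists>q\<in>V. initial q b) \<or>
       (\<exists>n. \<forall>q\<in>V. n \<le> pi1 q \<longrightarrow> \<not> (\<forall>i<n. bit_at q i \<longleftrightarrow> b i))" if "ce V" for V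
    proof -
      from gen' [OF that] consider e where "c e \<in> V" | e where "\<forall>q\<in>V. \<not> extends q (c e)" by blast
      then show ?thesis
      proof cases
        case 1
        with init show ?thesis by blast
      next
        case 2
        \<comment> \<open>A string of at least this length that agrees with \<open>b\<close> below
          \<open>pi1 (c e)\<close> would extend \<open>c e\<close>.\<close>
        then have "\<forall>q\<in>V. pi1 (c e) \<le> pi1 q \<longrightarrow> \<not> (\<forall>i<pi1 (c e). bit_at q i \<longleftrightarrow> b i)"
          using init [of e] by (auto simp: extends_def initial_def)
        then show ?thesis by blast
      qed
    qed
  qed
qed

section \<open>Structures with unary predicates\<close>

definition unary_lang :: lang where
  "unary_lang = \<lparr>Rels = UNIV, Funs = {}, rel_arity = \<lambda>_. 1, fun_arity = \<lambda>_. 0\<rparr>"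

definition unary_struct :: "(nat \<Rightarrow> nat \<Rightarrow> bool) \<Rightarrow> struct" where
  "unary_struct T = \<lparr>rel = \<lambda>r as. T (as ! 0) r, func = \<lambda>_ _. 0\<rparr>"

lemma unary_lang_simps [simp]:
  "Rels unary_lang = UNIV" "Funs unary_lang = {}" "rel_arity unary_lang r = 1"
  by (simp_all add: unary_lang_def)

lemma rel_unary_struct [simp]: "rel (unary_struct T) r as \<longleftrightarrow> T (as ! 0) r"
  by (simp add: unary_struct_def)

lemma tm_over_unary [simp]: "tm_over unary_lang t \<longleftrightarrow> (\<exists>i. t = Var i)"
  by (cases t) auto

lemma qf_over_unary [simp]:
  "qf_over unary_lang (Rel r ts) \<longleftrightarrow> (\<exists>i. ts = [Var i])"
  by (auto simp: length_Suc_conv)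

declare qf_over.simps(3) [simp del]

lemma isomorphism_unary:
  "isomorphism unary_lang (unary_struct T) (unary_struct T') h \<longleftrightarrow>
     bij h \<and> (\<forall>x r. T x r \<longleftrightarrow> T' (h x) r)"
proof -
  have "(\<forall>as. length as = 1 \<longrightarrow> (T (as ! 0) r \<longleftrightarrow> T' (map h as ! 0) r)) \<longleftrightarrow>
      (\<forall>x. T x r \<longleftrightarrow> T' (h x) r)" for r
    by (metis One_nat_def length_Cons length_map list.size(3) nth_Cons_0 nth_map zero_less_one)
  then show ?thesis by (auto simp: isomorphism_def)
qed

lemma qf_sat_unary_embed:
  assumes "inj g" "\<And>x r. T x r \<longleftrightarrow> T' (g x) r" "qf_over unary_lang p"
  shows "qf_sat (unary_struct T') (\<lambda>i. g (v i)) p \<longleftrightarrow> qf_sat (unary_struct T) v p"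
  using assms(3) by (induction p) (auto simp: assms(2) injD [OF assms(1)])

lemma qf_sat_unary_cong:
  assumes "qf_over unary_lang p" "\<And>i. i \<in> qf_vars p \<Longrightarrow> v i = v' i"
  shows "qf_sat (unary_struct T) v p \<longleftrightarrow> qf_sat (unary_struct T) v' p"
  using assms by (induction p) auto

lemma sat_Exs:
  "sat M (Exs k j \<phi>) v \<longleftrightarrow> (\<exists>v'. (\<forall>i. i \<notin> {k..<k + j} \<longrightarrow> v' i = v i) \<and> sat M \<phi> v')"
proof -
  have "sat M (foldr Ex is \<phi>) v \<longleftrightarrow> (\<exists>v'. (\<forall>i. i \<notin> set is \<longrightarrow> v' i = v i) \<and> sat M \<phi> v')" for "is"
  proof (induction "is" arbitrary: v)
    case Nil
    have "v' = v" if "\<forall>i. v' i = v i" for v' using that by auto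
    then show ?case by auto
  next
    case (Cons i "is")
    have "(\<exists>a. \<exists>v'. (\<forall>l. l \<notin> set is \<longrightarrow> v' l = (v(i := a)) l) \<and> sat M \<phi> v') \<longleftrightarrow>
        (\<exists>v'. (\<forall>l. l \<notin> set (i # is) \<longrightarrow> v' l = v l) \<and> sat M \<phi> v')" (is "?L \<longleftrightarrow> ?R")
    proof
      assume ?L
      then show ?R by (metis fun_upd_other list.set_intros(1,2))
    next
      assume ?R
      then obtain v' where v': "\<forall>l. l \<notin> set (i # is) \<longrightarrow> v' l = v l" "sat M \<phi> v'" by blast
      then have "\<forall>l. l \<notin> set is \<longrightarrow> v' l = (v(i := v' i)) l" by simp
      with v'(2) show ?L by blast
    qed
    then show ?case using Cons.IH by simp
  qed
  then show ?thesis by (simp add: Exs_def)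
qed

text \<open>Every assignment arises from itself by trivial updates, so under quantification over all
  assignments a block of universal quantifiers is redundant.\<close>

lemma sat_Alls_all: "(\<forall>v. sat M (Alls k j \<phi>) v) \<longleftrightarrow> (\<forall>v. sat M \<phi> v)"
proof -
  have "(\<forall>v. sat M (All i \<phi>) v) \<longleftrightarrow> (\<forall>v. sat M \<phi> v)" for i \<phi>
    by (auto, metis fun_upd_triv)
  then have "(\<forall>v. sat M (foldr All is \<phi>) v) \<longleftrightarrow> (\<forall>v. sat M \<phi> v)" for "is"
    by (induction "is") simp_all
  then show ?thesis by (simp add: Alls_def)
qed

text \<open>Satisfaction in \<open>unary_struct (case_nat X T)\<close>, where element \<open>0\<close> has type \<open>X\<close> and \<open>Suc s\<close> has
  type \<open>T s\<close>, as far as it is determined by the initial segment \<open>q\<close> of \<open>X\<close>.\<close>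

definition sat_axiom :: "(nat \<Rightarrow> nat \<Rightarrow> bool) \<Rightarrow> nat \<Rightarrow> nat \<Rightarrow> nat \<Rightarrow> nat \<Rightarrow> bool" where
  "sat_axiom T q v c t \<longleftrightarrow>
     c = qf_code Fls \<and> t = 0 \<or>
     (\<exists>i<Suc c. \<exists>j<Suc c. c = qf_code (Eq (Var i) (Var j)) \<and>
        t = (if seq v i = seq v j then 1 else 0)) \<or>
     (\<exists>r<Suc c. \<exists>i<Suc c. c = qf_code (Rel r [Var i]) \<and> (seq v i = 0 \<longrightarrow> r < pi1 q) \<and>
        t = (if seq v i = 0 \<and> bit_at q r \<or> 0 < seq v i \<and> T (seq v i - 1) r then 1 else 0))"

definition sat_rule :: "nat \<Rightarrow> nat \<Rightarrow> nat \<Rightarrow> nat \<Rightarrow> nat \<Rightarrow> nat \<Rightarrow> bool" where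
  "sat_rule c1 t1 c2 t2 c t \<longleftrightarrow>
     c = prod_encode (3, c1) \<and> t = 1 - t1 \<or>
     c = prod_encode (4, prod_encode (c1, c2)) \<and> t = (if t1 = 1 \<and> t2 = 1 then 1 else 0) \<or>
     c = prod_encode (5, prod_encode (c1, c2)) \<and> t = (if t1 = 1 \<or> t2 = 1 then 1 else 0)"

abbreviation sat_axiom' :: "(nat \<Rightarrow> nat \<Rightarrow> bool) \<Rightarrow> nat \<Rightarrow> nat \<Rightarrow> bool" where
  "sat_axiom' T par z \<equiv> sat_axiom T (pi1 par) (pi2 par) (pi1 z) (pi2 z)"

abbreviation sat_rule' :: "nat \<Rightarrow> nat \<Rightarrow> nat \<Rightarrow> bool" where
  "sat_rule' a b z \<equiv> sat_rule (pi1 a) (pi2 a) (pi1 b) (pi2 b) (pi1 z) (pi2 z)"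

text \<open>Variables and predicate symbols are bounded by the code of the literal in which they
  occur. So the bounded quantifiers in \<open>sat_axiom\<close> lose nothing, and bounded search
  decides the atomic diagram.\<close>

lemma le_code:
  "i \<le> qf_code (Eq (Var i) (Var j))" "j \<le> qf_code (Eq (Var i) (Var j))"
  "r \<le> qf_code (Rel r [Var i])" "i \<le> qf_code (Rel r [Var i])"
  "qf_code p \<le> qf_code (Neg p)"
  by (simp_all, (meson le_prod_encode_1 le_prod_encode_2 le_SucI order.trans)+)

lemma qf_code_eq_iff: "qf_code p = qf_code p' \<longleftrightarrow> p = p'"
  using qf_code_inject by blast

text \<open>For the element 0 a derivation consults only bits within the length of \<open>q\<close>,
  so its verdict is correct for every \<open>X\<close> with initial segment
  \<open>q\<close>.\<close>

lemma sat_code_sound: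
  assumes "initial q X" "derivable (sat_axiom' T (prod_encode (q, v))) sat_rule' z"
    and "qf_over unary_lang p" "pi1 z = qf_code p"
  shows "pi2 z = (if qf_sat (unary_struct (case_nat X T)) (seq v) p then 1 else 0)"
  using assms(2-4)
proof (induction arbitrary: p rule: derivable.induct)
  case (axiom z)
  from axiom.hyps [unfolded sat_axiom_def pi_prod_encode axiom.prems(2) qf_code_eq_iff]
  show ?case
  proof (elim disjE exE conjE)
    fix r i
    assume "p = Rel r [Var i]" "seq v i = 0 \<longrightarrow> r < pi1 q"
      "pi2 z = (if seq v i = 0 \<and> bit_at q r \<or> 0 < seq v i \<and> T (seq v i - 1) r then 1 else 0)"
    then show ?thesis using assms(1) by (cases "seq v i") (auto simp: initial_def)
  qed auto
next
  case (step a b z)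
  from step.hyps(3) [unfolded sat_rule_def] step.prems(2)
  show ?case
  proof (elim disjE conjE)
    assume *: "pi1 z = prod_encode (3, pi1 a)" "pi2 z = 1 - pi2 a"
    then obtain p' where "p = Neg p'" "pi1 a = qf_code p'"
      using step.prems(2) by (cases p) auto
    then show ?thesis using * step.IH(1) [of p'] step.prems by auto
  next
    assume *: "pi1 z = prod_encode (4, prod_encode (pi1 a, pi1 b))"
      "pi2 z = (if pi2 a = 1 \<and> pi2 b = 1 then 1 else 0)"
    then obtain p1 p2 where "p = And p1 p2" "pi1 a = qf_code p1" "pi1 b = qf_code p2"
      using step.prems(2) by (cases p) auto
    then show ?thesis using * step.IH(1) [of p1] step.IH(2) [of p2] step.prems by auto
  next
    assume *: "pi1 z = prod_encode (5, prod_encode (pi1 a, pi1 b))"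
      "pi2 z = (if pi2 a = 1 \<or> pi2 b = 1 then 1 else 0)"
    then obtain p1 p2 where "p = Or p1 p2" "pi1 a = qf_code p1" "pi1 b = qf_code p2"
      using step.prems(2) by (cases p) auto
    then show ?thesis using * step.IH(1) [of p1] step.IH(2) [of p2] step.prems by auto
  qed
qed

text \<open>A finitary formula mentions finitely many predicates, so every sufficiently long initial
  segment of \<open>X\<close> decides it.\<close>

lemma sat_code_complete:
  assumes "qf_over unary_lang p"
  shows "\<exists>n. \<forall>q. n \<le> pi1 q \<longrightarrow> initial q X \<longrightarrow>
    derivable (sat_axiom' T (prod_encode (q, v))) sat_rule'
      (prod_encode (qf_code p,
        if qf_sat (unary_struct (case_nat X T)) (seq v) p then 1 else 0))"
proof -
  let ?t = "\<lambda>p. if qf_sat (unary_struct (case_nat X T)) (seq v) p then 1 else (0::nat)"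
  let ?D = "\<lambda>q p. derivable (sat_axiom' T (prod_encode (q, v))) sat_rule'
    (prod_encode (qf_code p, ?t p))"
  have ax: "?D q p" if "sat_axiom T q v (qf_code p) (?t p)" for q p
    using that by (intro derivable.axiom) simp
  let ?E = "\<lambda>p. \<exists>n. \<forall>q. n \<le> pi1 q \<longrightarrow> initial q X \<longrightarrow> ?D q p"
  have rule: "?E p" if "?E p1" "?E p2"
    "sat_rule (qf_code p1) (?t p1) (qf_code p2) (?t p2) (qf_code p) (?t p)" for p p1 p2
  proof -
    have D: "?D q p" if "?D q p1" "?D q p2" for q
      using that
      by (rule derivable.step)
        (simp only: pi_prod_encode \<open>sat_rule _ _ _ _ (qf_code p) (?t p)\<close>)
    from \<open>?E p1\<close> \<open>?E p2\<close> obtain n1 n2 where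
      n1: "\<forall>q. n1 \<le> pi1 q \<longrightarrow> initial q X \<longrightarrow> ?D q p1" and
      n2: "\<forall>q. n2 \<le> pi1 q \<longrightarrow> initial q X \<longrightarrow> ?D q p2" by blast
    have "?D q p" if "max n1 n2 \<le> pi1 q" "initial q X" for q
      using n1 n2 that by (intro D) (simp_all only: max.bounded_iff)
    then show ?thesis by blast
  qed
  have "\<exists>n. \<forall>q. n \<le> pi1 q \<longrightarrow> initial q X \<longrightarrow> ?D q p"
    using assms
  proof (induction p)
    case Fls
    show ?case using ax [of _ Fls] by (simp add: sat_axiom_def)
  next
    case (Eq s t)
    then obtain i j where ij: "s = Var i" "t = Var j" by auto
    have "sat_axiom T q v (qf_code (Eq s t)) (?t (Eq s t))" for q
      unfolding sat_axiom_def ij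
      by (intro disjI2 disjI1 exI [of _ i] exI [of _ j] conjI) (auto simp: less_Suc_eq_le le_code simp del: qf_code.simps)
    then show ?case using ax by blast
  next
    case (Rel r ts)
    then obtain i where i: "ts = [Var i]" by auto
    have "sat_axiom T q v (qf_code (Rel r ts)) (?t (Rel r ts))"
      if "Suc r \<le> pi1 q" "initial q X" for q
      unfolding sat_axiom_def i using that
      by (intro disjI2 disjI1 exI [of _ i] exI [of _ r] conjI)
        (auto simp: less_Suc_eq_le le_code initial_def split: nat.split simp del: qf_code.simps)
    then show ?case using ax by blast
  next
    case (Neg p)
    from Neg have "?E p" by simp
    \<comment> \<open>Negation has a single premise, which is supplied twice.\<close>
    from this this show ?case by (rule rule) (simp add: sat_rule_def)
  next
    case (And p1 p2)
    from And have "?E p1" "?E p2" by simp_all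
    then show ?case by (rule rule) (simp add: sat_rule_def)
  next
    case (Or p1 p2)
    from Or have "?E p1" "?E p2" by simp_all
    then show ?case by (rule rule) (simp add: sat_rule_def)
  qed
  then show ?thesis .
qed

section \<open>Transfer of formulas to the extended structure\<close>

lemma decidable_sat_code:
  assumes T: "\<And>f g. recursive f \<Longrightarrow> recursive g \<Longrightarrow> decidable (\<lambda>x. T (f x) (g x))"
    and fgh: "recursive f" "recursive g" "recursive h"
  shows "decidable (\<lambda>x. cert (sat_axiom' T (f x)) sat_rule' (g x) (h x))"
proof -
  have "decidable (\<lambda>x. sat_axiom' T (f x) (g x))" if "recursive f" "recursive g" for f g
    unfolding sat_axiom_def bit_at_def qf_code.simps tm_code.simps list.map list_encode.simps
    by (intro recursive_intros T that recursive_compose [OF that(1)] recursive_compose [OF that(2)])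
  moreover have "decidable (\<lambda>x. sat_rule' (f x) (g x) (h x))"
    if "recursive f" "recursive g" "recursive h" for f g h
    unfolding sat_rule_def by (intro recursive_intros that)
  ultimately show ?thesis
    using decidable_cert [of "sat_axiom' T" "\<lambda>_. sat_rule'" f g h] fgh by simp
qed

section \<open>C.e. indices and the shape of computable \<Sigma>_1 formulas\<close>

lemma ce_eq_W:
  assumes "ce V"
  obtains e where "W e = V"
proof -
  obtain p where "V = {x. run p x \<noteq> None}" using assms unfolding ce_def by blast
  then have "W (prog_code p) = V" unfolding W_def using prog_code_inject by blast
  then show ?thesis by (rule that)
qed

text \<open>A disjunction with one member and an empty quantifier block. This yields the \<Sigma>_1
  definitions of orbits and lifts \<Sigma>_0 matrices to level 1.\<close>

lemma Sigma_1_of_qf: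
  assumes "qf_over L p" "qf_vars p \<subseteq> {..<k}"
  shows "\<exists>e \<phi>. Sigma_index L k 1 e \<phi> \<and> (\<forall>M v. sat M \<phi> v \<longleftrightarrow> qf_sat M v p)"
proof -
  let ?z = "prod_encode (0, prod_encode (0, qf_code p))"
  have "ce {x. \<exists>y::nat. x = ?z}" by (intro ce_ex recursive_intros)
  then obtain e where e: "W e = {?z}" using ce_eq_W [of "{?z}"] by auto
  have "Sigma_index L k 1 e (Disj (csingle (QF p)))"
  proof (rule Sigma_index_Pi_index.Sigma_pos [where D = "\<lambda>_. QF p"])
    show "\<forall>z\<in>W e. \<exists>j m i \<psi>. z = prod_encode (j, prod_encode (m, i)) \<and> m < 1 \<and>
        Pi_index L (k + j) m i \<psi> \<and> QF p = Exs k j \<psi>"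
    proof
      fix z assume "z \<in> W e"
      then show "\<exists>j m i \<psi>. z = prod_encode (j, prod_encode (m, i)) \<and> m < 1 \<and>
        Pi_index L (k + j) m i \<psi> \<and> QF p = Exs k j \<psi>"
        using e Sigma_index_Pi_index.Pi_0 [OF assms(1), of k] assms(2)
        by (intro exI [of _ 0] exI [of _ "qf_code p"] exI [of _ "QF p"]) (simp add: Exs_def)
    qed
    show "rcset (csingle (QF p)) = (\<lambda>_. QF p) ` W e" by (simp add: e cinsert.rep_eq bot_cset.rep_eq)
  qed simp
  moreover have "sat M (Disj (csingle (QF p))) v \<longleftrightarrow> qf_sat M v p" for M v
    by (simp add: cinsert.rep_eq bot_cset.rep_eq)
  ultimately show ?thesis by blast
qed

text \<open>Below level 1 only quantifier-free matrices occur, and \<open>qf_code\<close> is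
  injective, so each disjunct can be recovered from its code and satisfaction depends on
  \<open>W e\<close> alone.\<close>

lemma Sigma_1_sat_iff:
  assumes "Sigma_index L k 1 e \<psi>"
  shows "sat M \<psi> v \<longleftrightarrow> (\<exists>j p v'. prod_encode (j, prod_encode (0, qf_code p)) \<in> W e \<and>
    (\<forall>i. i \<notin> {k..<k + j} \<longrightarrow> v' i = v i) \<and> qf_sat M v' p)"
    and "prod_encode (j, prod_encode (0, qf_code p)) \<in> W e \<Longrightarrow>
      qf_over L p \<and> qf_vars p \<subseteq> {..<k + j}"
    and "z \<in> W e \<Longrightarrow> \<exists>j p. z = prod_encode (j, prod_encode (0, qf_code p))"
proof -
  obtain D S where S: "\<psi> = Disj S" "rcset S = D ` W e"
    and D: "\<forall>z\<in>W e. \<exists>j m i \<psi>. z = prod_encode (j, prod_encode (m, i)) \<and> m < 1 \<and>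
        Pi_index L (k + j) m i \<psi> \<and> D z = Exs k j \<psi>"
    using assms by (cases rule: Sigma_index.cases) auto
  have D': "\<exists>j p. z = prod_encode (j, prod_encode (0, qf_code p)) \<and> qf_over L p \<and>
      qf_vars p \<subseteq> {..<k + j} \<and> D z = Exs k j (QF p)" if zW: "z \<in> W e" for z
  proof -
    obtain j i \<chi> where z: "z = prod_encode (j, prod_encode (0, i))"
      "Pi_index L (k + j) 0 i \<chi>" "D z = Exs k j \<chi>"
      using D zW by auto
    from z(2) obtain p where "\<chi> = QF p" "i = qf_code p" "qf_over L p" "qf_vars p \<subseteq> {..<k + j}"
      by (cases rule: Pi_index.cases) auto
    with z show ?thesis by blast
  qed
  have D'': "qf_over L p \<and> qf_vars p \<subseteq> {..<k + j} \<and>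
      D (prod_encode (j, prod_encode (0, qf_code p))) = Exs k j (QF p)"
    if "prod_encode (j, prod_encode (0, qf_code p)) \<in> W e" for j p
    using D' [OF that] by (auto simp: qf_code_eq_iff)
  have "sat M \<psi> v \<longleftrightarrow> (\<exists>z\<in>W e. sat M (D z) v)"
    by (simp add: S sat_Disj_iff del: sat.simps)
  also have "\<dots> \<longleftrightarrow> (\<exists>j p. prod_encode (j, prod_encode (0, qf_code p)) \<in> W e \<and>
      sat M (Exs k j (QF p)) v)"
    using D' D'' by metis
  finally show "sat M \<psi> v \<longleftrightarrow> (\<exists>j p v'. prod_encode (j, prod_encode (0, qf_code p)) \<in> W e \<and>
    (\<forall>i. i \<notin> {k..<k + j} \<longrightarrow> v' i = v i) \<and> qf_sat M v' p)"
    by (simp add: sat_Exs)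
  show "prod_encode (j, prod_encode (0, qf_code p)) \<in> W e \<Longrightarrow>
      qf_over L p \<and> qf_vars p \<subseteq> {..<k + j}"
    using D'' by blast
  show "z \<in> W e \<Longrightarrow> \<exists>j p. z = prod_encode (j, prod_encode (0, qf_code p))"
    using D' by blast
qed

lemma eventually_agree:
  assumes "\<And>r::nat. \<exists>N. \<forall>s\<ge>N. T s r \<longleftrightarrow> b r"
  shows "\<exists>N::nat. \<forall>s\<ge>N. \<forall>r<n. T s r \<longleftrightarrow> b r"
proof (induction n)
  case (Suc n)
  then obtain N where "\<forall>s\<ge>N. \<forall>r<n. T s r \<longleftrightarrow> b r" ..
  moreover obtain M where "\<forall>s\<ge>M. T s n \<longleftrightarrow> b n" using assms by blast
  ultimately have "\<forall>s\<ge>max N M. \<forall>r<Suc n. T s r \<longleftrightarrow> b r" by (simp add: less_Suc_eq)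
  then show ?case ..
qed simp

text \<open>Let \<open>V\<close> be the c.e. set of strings that force \<open>\<psi>\<close> at the
  values \<open>v\<close>. For large \<open>s\<close>, long initial segments of \<open>T s\<close>
  lie in \<open>V\<close> and agree with \<open>b\<close> far out, so \<open>V\<close> is not
  avoided. Genericity puts an initial segment of \<open>b\<close> into \<open>V\<close>, and
  \<open>sat_code_sound\<close> concludes.\<close>

lemma Sigma_1_transfer:
  assumes T: "\<And>f g. recursive f \<Longrightarrow> recursive g \<Longrightarrow> decidable (\<lambda>x. T (f x) (g x))"
    and lim: "\<And>r. \<exists>N. \<forall>s\<ge>N. T s r \<longleftrightarrow> b r"
    and gen: "\<And>V. ce V \<Longrightarrow> (\<exists>q\<in>V. initial q b) \<or>
       (\<exists>n. \<forall>q\<in>V. n \<le> pi1 q \<longrightarrow> \<not> (\<forall>i<n. bit_at q i \<longleftrightarrow> b i))"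
    and \<psi>: "Sigma_index unary_lang k 1 e \<psi>"
    and A: "\<And>v. sat (unary_struct T) \<psi> v"
  shows "sat (unary_struct (case_nat b T)) \<psi> v"
proof -
  note sat_iff = Sigma_1_sat_iff(1) [OF \<psi>]
  \<comment> \<open>Numbers that code no program index the empty set, so nonemptiness yields a
    program for \<open>e\<close>.\<close>
  have "W e \<noteq> {}" using A [of id] by (auto simp: sat_iff)
  then obtain p0 where "prog_code p0 = e" unfolding W_def by blast
  then have We: "W e = {z. \<exists>w. halting_witness e z w}"
    unfolding W_def using halts_iff_witness prog_code_inject by blast
  obtain u where u: "\<forall>i<k. seq u i = v i" using seq_exists by metis
  \<comment> \<open>\<open>y\<close> packs a disjunct, a witness that it belongs to
    \<open>W e\<close>, an assignment extending \<open>v\<close> on the free variables, and a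
    certificate that the matrix holds.\<close>
  define V where "V = {q. \<exists>y. halting_witness e (pi1 y) (pi1 (pi2 y)) \<and>
    (\<forall>i<k. seq (pi1 (pi2 (pi2 y))) i = seq u i) \<and>
    cert (sat_axiom' T (prod_encode (q, pi1 (pi2 (pi2 y))))) sat_rule'
      (prod_encode (pi2 (pi2 (pi1 y)), 1)) (pi2 (pi2 (pi2 y)))}"
  have V_iff: "q \<in> V \<longleftrightarrow> (\<exists>z\<in>W e. \<exists>c. (\<forall>i<k. seq c i = v i) \<and>
    derivable (sat_axiom' T (prod_encode (q, c))) sat_rule' (prod_encode (pi2 (pi2 z), 1)))"
    (is "_ \<longleftrightarrow> ?R") for q
  proof
    assume "q \<in> V"
    then show ?R using u unfolding V_def We derivable_iff_cert by auto
  next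
    assume ?R
    then obtain z w c w' where "halting_witness e z w" "\<forall>i<k. seq c i = v i"
      "cert (sat_axiom' T (prod_encode (q, c))) sat_rule' (prod_encode (pi2 (pi2 z), 1)) w'"
      unfolding We derivable_iff_cert by blast
    then show "q \<in> V" unfolding V_def
      by (intro CollectI exI [of _ "prod_encode (z, prod_encode (w, prod_encode (c, w')))"])
        (simp add: u)
  qed
  have "ce V"
    unfolding V_def
    by (intro ce_ex recursive_intros decidable_halting_witness decidable_sat_code [OF T])
  moreover have "\<exists>q\<in>V. n \<le> pi1 q \<and> (\<forall>i<n. bit_at q i \<longleftrightarrow> b i)" for n
  proof -
    obtain N where N: "\<forall>s\<ge>N. \<forall>r<n. T s r \<longleftrightarrow> b r"
      using eventually_agree [of T b, OF lim] by blast
    \<comment> \<open>Beyond \<open>N\<close>, so that \<open>T s\<close> agrees with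
      \<open>b\<close> below \<open>n\<close>; beyond all values of \<open>v\<close> below
      \<open>k\<close>, so that \<open>v\<close> avoids the original copy \<open>Suc s\<close> of
      \<open>s\<close>.\<close>
    define s where "s = Suc (N + sum v {..<k})"
    have s: "\<forall>r<n. T s r \<longleftrightarrow> b r" using N by (simp add: s_def)
    have vs: "v i \<noteq> Suc s" if "i < k" for i
    proof -
      have "v i \<le> sum v {..<k}" using that by (intro member_le_sum) auto
      then show ?thesis by (simp add: s_def)
    qed
    \<comment> \<open>Moving the element \<open>s\<close> to \<open>0\<close> embeds \<open>A\<close> in the extension of \<open>A\<close> by a second copy of \<open>s\<close>.\<close>
    define g where "g x = (if x = s then 0 else Suc x)" for x
    have "inj g" by (auto simp: g_def inj_def)
    have gT: "T x r \<longleftrightarrow> case_nat (T s) T (g x) r" for x r by (simp add: g_def)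
    \<comment> \<open>The assignment is pulled back along \<open>g\<close>: 0 becomes
      \<open>s\<close>, and every other element is shifted down.\<close>
    obtain j p v' where z: "prod_encode (j, prod_encode (0, qf_code p)) \<in> W e"
      and v': "\<forall>i. i \<notin> {k..<k + j} \<longrightarrow> v' i = (if v i = 0 then s else v i - 1)"
      and sat: "qf_sat (unary_struct T) v' p"
      using A [of "\<lambda>i. if v i = 0 then s else v i - 1"] unfolding sat_iff by blast
    note p = Sigma_1_sat_iff(2) [OF \<psi> z]
    obtain c where c: "\<forall>i<k + j. seq c i = g (v' i)"
      using seq_exists [of "k + j" "\<lambda>i. g (v' i)"] ..
    have cv: "seq c i = v i" if "i < k" for i
    proof -
      have "seq c i = g (if v i = 0 then s else v i - 1)" using c v' that by simp
      then show ?thesis using vs [OF that] by (auto simp: g_def)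
    qed
    have "qf_sat (unary_struct (case_nat (T s) T)) (\<lambda>i. g (v' i)) p"
      using qf_sat_unary_embed [of g T "case_nat (T s) T" p v', OF \<open>inj g\<close> gT] p sat by blast
    then have sat': "qf_sat (unary_struct (case_nat (T s) T)) (seq c) p"
      using qf_sat_unary_cong [of p "\<lambda>i. g (v' i)" "seq c" "case_nat (T s) T"] p c by fastforce
    then obtain m where m: "\<forall>q. m \<le> pi1 q \<longrightarrow> initial q (T s) \<longrightarrow>
      derivable (sat_axiom' T (prod_encode (q, c))) sat_rule' (prod_encode (qf_code p, 1))"
      using sat_code_complete [of p "T s" T c] p by auto
    obtain q where q: "pi1 q = max n m" "initial q (T s)" using initial_exists by blast
    then have "q \<in> V" unfolding V_iff
      using m z cv by (intro bexI [OF _ z] exI [of _ c]) auto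
    moreover have "\<forall>i<n. bit_at q i \<longleftrightarrow> b i" using q s by (simp add: initial_def)
    moreover have "n \<le> pi1 q" using q by simp
    ultimately show ?thesis by blast
  qed
  ultimately obtain q where q: "q \<in> V" "initial q b" using gen [of V] by blast
  then obtain z c where z: "z \<in> W e" and c: "\<forall>i<k. seq c i = v i"
    "derivable (sat_axiom' T (prod_encode (q, c))) sat_rule' (prod_encode (pi2 (pi2 z), 1))"
    unfolding V_iff by blast
  from Sigma_1_sat_iff(3) [OF \<psi> z] obtain j p
    where zp: "z = prod_encode (j, prod_encode (0, qf_code p))" by blast
  note p = Sigma_1_sat_iff(2) [OF \<psi> z [unfolded zp]]
  have "qf_sat (unary_struct (case_nat b T)) (seq c) p"
    using sat_code_sound [OF q(2) c(2), of p] p zp by (simp split: if_splits)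
  \<comment> \<open>\<open>c\<close> is controlled only below \<open>k\<close>; from
    \<open>k + j\<close> on it is replaced by \<open>v\<close>, so that the two assignments differ
    only on the quantified block.\<close>
  then have "qf_sat (unary_struct (case_nat b T)) (\<lambda>i. if i < k + j then seq c i else v i) p"
    using qf_sat_unary_cong [of p "seq c" "\<lambda>i. if i < k + j then seq c i else v i"
        "case_nat b T"] p by fastforce
  then show ?thesis unfolding sat_iff
    using z zp c(1) by (intro exI [of _ j] exI [of _ p]
        exI [of _ "\<lambda>i. if i < k + j then seq c i else v i"]) auto
qed

text \<open>In a model every conjunct holds under all assignments, so its universal block can be
  stripped; the matrix, lifted to level 1 if necessary, is then transferred.\<close>

lemma Pi_2_transfer:
  assumes T: "\<And>f g. recursive f \<Longrightarrow> recursive g \<Longrightarrow> decidable (\<lambda>x. T (f x) (g x))"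
    and lim: "\<And>r. \<exists>N. \<forall>s\<ge>N. T s r \<longleftrightarrow> b r"
    and gen: "\<And>V. ce V \<Longrightarrow> (\<exists>q\<in>V. initial q b) \<or>
       (\<exists>n. \<forall>q\<in>V. n \<le> pi1 q \<longrightarrow> \<not> (\<forall>i<n. bit_at q i \<longleftrightarrow> b i))"
    and \<phi>: "Pi_index unary_lang k 2 e \<phi>"
    and A: "models (unary_struct T) \<phi>"
  shows "models (unary_struct (case_nat b T)) \<phi>"
proof -
  let ?B = "unary_struct (case_nat b T)"
  obtain D S where S: "\<phi> = Conj S" "rcset S = D ` W e"
    and D: "\<forall>z\<in>W e. \<exists>j m i \<psi>. z = prod_encode (j, prod_encode (m, i)) \<and> m < 2 \<and>
        Sigma_index unary_lang (k + j) m i \<psi> \<and> D z = Alls k j \<psi>"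
    using \<phi> by (cases rule: Pi_index.cases) auto
  have "\<forall>v. sat ?B (D z) v" if z: "z \<in> W e" for z
  proof -
    obtain j m i \<psi> where m: "m < 2" and \<psi>: "Sigma_index unary_lang (k + j) m i \<psi>"
      and Dz: "D z = Alls k j \<psi>" using D z by blast
    have "\<forall>v. sat (unary_struct T) (D z) v"
      using A z by (simp add: models_def S sat_Conj_iff del: sat.simps)
    then have A\<psi>: "sat (unary_struct T) \<psi> v" for v
      unfolding Dz sat_Alls_all by blast
    obtain i' \<psi>' where \<psi>': "Sigma_index unary_lang (k + j) 1 i' \<psi>'"
      "\<And>M v. sat M \<psi>' v \<longleftrightarrow> sat M \<psi> v"
    proof (cases "m = 0")
      case True
      with \<psi> obtain p where "\<psi> = QF p" "qf_over unary_lang p" "qf_vars p \<subseteq> {..<k + j}"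
        by (cases rule: Sigma_index.cases) auto
      then show ?thesis using Sigma_1_of_qf that by (metis sat.simps(1))
    next
      case False
      with m have "m = 1" by simp
      with \<psi> that show ?thesis by blast
    qed
    have "sat ?B \<psi>' v" for v
      by (rule Sigma_1_transfer [OF T lim gen \<psi>'(1)]) (simp_all add: \<psi>'(2) A\<psi>)
    then show ?thesis unfolding Dz sat_Alls_all \<psi>'(2) by blast
  qed
  then show ?thesis by (simp add: models_def S sat_Conj_iff del: sat.simps)
qed

section \<open>Computability and definable orbits\<close>

lemma computable_set_decidable: "decidable (\<lambda>x. x \<in> S) \<Longrightarrow> computable_set S"
  unfolding decidable_def recursive_def computable_set_def .

lemma computable_unary_lang: "computable_lang unary_lang"
proof -
  have "recursive f \<Longrightarrow> computable_on S f" for f S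
    unfolding recursive_def computable_on_def by blast
  then show ?thesis
    unfolding computable_lang_def unary_lang_def
    by (auto intro!: computable_set_decidable recursive_const decidable_const)
qed

lemma computable_unary_struct:
  assumes T: "\<And>f g. recursive f \<Longrightarrow> recursive g \<Longrightarrow> decidable (\<lambda>x. T (f x) (g x))"
  shows "computable_struct unary_lang (unary_struct T)"
proof -
  \<comment> \<open>The four shapes share the indices; in the last two \<open>i\<close> is the
    predicate and \<open>j\<close> the element.\<close>
  define Q where "Q p i j \<longleftrightarrow>
    p = Eq (Var i) (Var j) \<and> i = j \<or> p = Neg (Eq (Var i) (Var j)) \<and> i \<noteq> j \<or>
    p = Rel i [Var j] \<and> T j i \<or> p = Neg (Rel i [Var j]) \<and> \<not> T j i" for p i j
  define P where "P c i j \<longleftrightarrow> (\<exists>p. Q p i j \<and> c = qf_code p)" for c i j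
  have P_iff: "P c i j \<longleftrightarrow>
    c = qf_code (Eq (Var i) (Var j)) \<and> i = j \<or>
    c = qf_code (Neg (Eq (Var i) (Var j))) \<and> i \<noteq> j \<or>
    c = qf_code (Rel i [Var j]) \<and> T j i \<or>
    c = qf_code (Neg (Rel i [Var j])) \<and> \<not> T j i" for c i j
    unfolding P_def Q_def by blast
  have le: "i < Suc c \<and> j < Suc c" if "P c i j" for c i j
    using that le_code(1-4) le_code(5) [THEN order.trans [rotated]]
    unfolding P_iff less_Suc_eq_le by blast
  have atomic: "atomic p \<and> qf_over unary_lang p \<longleftrightarrow>
      (\<exists>i j. p = Eq (Var i) (Var j) \<or> p = Rel i [Var j])" for p
    by (cases p) auto
  have diagram: "p \<in> atomic_diagram unary_lang (unary_struct T) \<longleftrightarrow> (\<exists>i j. Q p i j)" for p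
  proof -
    have "p \<in> atomic_diagram unary_lang (unary_struct T) \<longleftrightarrow>
      (atomic p \<and> qf_over unary_lang p \<and> qf_sat (unary_struct T) id p \<or>
       (\<exists>q. (atomic q \<and> qf_over unary_lang q) \<and> p = Neg q \<and> \<not> qf_sat (unary_struct T) id q))"
      unfolding atomic_diagram_def by auto
    also have "\<dots> \<longleftrightarrow> (\<exists>i j. Q p i j)"
      unfolding atomic Q_def conj_assoc [symmetric] by (auto 0 4)
    finally show ?thesis .
  qed
  have "c \<in> qf_code ` atomic_diagram unary_lang (unary_struct T) \<longleftrightarrow> (\<exists>i j. P c i j)" for c
    unfolding P_def image_iff Bex_def diagram by blast
  then have "qf_code ` atomic_diagram unary_lang (unary_struct T) =
      {c. \<exists>i<Suc c. \<exists>j<Suc c. P c i j}"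
    using le by blast
  moreover have "decidable (\<lambda>c. \<exists>i<Suc c. \<exists>j<Suc c. P c i j)"
    unfolding P_iff qf_code.simps tm_code.simps list.map list_encode.simps
    by (intro recursive_intros T)
  ultimately show ?thesis
    unfolding computable_struct_def by (simp add: computable_set_decidable)
qed

section \<open>Definability of orbits from isolated types\<close>

lemma foldr_And:
  "qf_sat M v (foldr And ps (Neg Fls)) \<longleftrightarrow> (\<forall>p\<in>set ps. qf_sat M v p)"
  "qf_over L (foldr And ps (Neg Fls)) \<longleftrightarrow> (\<forall>p\<in>set ps. qf_over L p)"
  "qf_vars (foldr And ps (Neg Fls)) = (\<Union>p\<in>set ps. qf_vars p)"
  by (induction ps) auto

text \<open>Each element is determined by finitely many predicates, so the identity is the only
  automorphism and every orbit is a singleton; the conjunction of these literals for all entries of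
  \<open>as\<close> defines it.\<close>

lemma orbit_definable:
  assumes isolated: "\<And>s. \<exists>d. \<forall>s'. (\<forall>r<d. T s' r \<longleftrightarrow> T s r) \<longrightarrow> s' = s"
  shows "\<exists>p. qf_over unary_lang p \<and> qf_vars p \<subseteq> {..<length as} \<and>
    orbit unary_lang (unary_struct T) as = defined_set (unary_struct T) (length as) (QF p)"
proof -
  obtain d where d: "\<And>s s'. (\<forall>r<d s. T s' r \<longleftrightarrow> T s r) \<Longrightarrow> s' = s"
    using isolated by metis
  define lit where "lit k r =
    (if T (as ! k) r then Rel r [Var k] else Neg (Rel r [Var k]))" for k r
  define p where "p = foldr And
    (concat (map (\<lambda>k. map (lit k) [0..<d (as ! k)]) [0..<length as])) (Neg Fls)"
  have "orbit unary_lang (unary_struct T) as = {as}"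
  proof -
    have id: "h = id" if "isomorphism unary_lang (unary_struct T) (unary_struct T) h" for h
      using that d by (auto simp: isomorphism_unary)
    moreover have "isomorphism unary_lang (unary_struct T) (unary_struct T) id"
      by (simp add: isomorphism_unary)
    ultimately show ?thesis unfolding orbit_def by (force dest: id)
  qed
  moreover have "bs = as" if "length bs = length as"
    "\<And>k r. k < length as \<Longrightarrow> r < d (as ! k) \<Longrightarrow> T (bs ! k) r \<longleftrightarrow> T (as ! k) r" for bs
    using that d by (intro nth_equalityI) auto
  moreover have "qf_sat (unary_struct T) v p \<longleftrightarrow>
      (\<forall>k<length as. \<forall>r<d (as ! k). T (v k) r \<longleftrightarrow> T (as ! k) r)" for v
  proof -
    have "qf_sat (unary_struct T) v (lit k r) \<longleftrightarrow> (T (v k) r \<longleftrightarrow> T (as ! k) r)" for k r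
      by (simp add: lit_def)
    then show ?thesis unfolding p_def foldr_And by fastforce
  qed
  ultimately have "orbit unary_lang (unary_struct T) as =
      defined_set (unary_struct T) (length as) (QF p)"
    unfolding defined_set_def by auto
  moreover have "qf_over unary_lang p" "qf_vars p \<subseteq> {..<length as}"
    unfolding p_def foldr_And by (auto simp: lit_def split: if_splits)
  ultimately show ?thesis by blast
qed

theorem proposition2p8:
  shows "\<exists>L A. computable_lang L \<and> computable_struct L A \<and>
    (\<forall>as.
       (\<exists>\<phi>. computable_Sigma L 1 (length as) \<phi> \<and>
            orbit L A as = defined_set A (length as) \<phi>) \<and>
       (\<exists>\<phi>. qf_formula L (length as) \<phi> \<and>
            orbit L A as = defined_set A (length as) \<phi>)) \<and>
    \<not> (\<exists>\<phi>. computable_Pi L 2 0 \<phi> \<and> scott_sentence L A \<phi>)"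
proof (rule generic_sequence)
  fix T b
  assume T: "\<And>f g. recursive f \<Longrightarrow> recursive g \<Longrightarrow> decidable (\<lambda>x. T (f x) (g x))"
    and diag: "\<And>s. T s s" and above: "\<And>s r. s < r \<Longrightarrow> \<not> T s r"
    and lim: "\<And>r. \<exists>N. \<forall>s\<ge>N. T s r \<longleftrightarrow> b r" and inf: "\<And>n. \<exists>r\<ge>n. b r"
    and gen: "\<And>V. ce V \<Longrightarrow> (\<exists>q\<in>V. initial q b) \<or>
       (\<exists>n. \<forall>q\<in>V. n \<le> pi1 q \<longrightarrow> \<not> (\<forall>i<n. bit_at q i \<longleftrightarrow> b i))"
  let ?A = "unary_struct T" and ?B = "unary_struct (case_nat b T)"
  have "\<exists>d. \<forall>s'. (\<forall>r<d. T s' r \<longleftrightarrow> T s r) \<longrightarrow> s' = s" for s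
  proof -
    \<comment> \<open>\<open>T s\<close> omits \<open>r\<close>, while all later \<open>T s'\<close>
      contain it. So only \<open>s' < N\<close> can agree with \<open>s\<close>, and agreement at
      both \<open>s\<close> and \<open>s'\<close> then forces equal maxima.\<close>
    obtain r where r: "Suc s \<le> r" "b r" using inf by blast
    obtain N where N: "\<forall>s'\<ge>N. T s' r \<longleftrightarrow> b r" using lim by blast
    have "s' = s" if eq: "\<forall>i<Suc (r + N). T s' i \<longleftrightarrow> T s i" for s'
    proof -
      have "\<not> T s' r" using eq above [of s r] r by simp
      then have "s' < N" using N r(2) by (meson not_le)
      then have "T s s'" "T s' s" using eq diag [of s] diag [of s'] r(1) by simp_all
      then show ?thesis using above by (meson linorder_neqE_nat)
    qed
    then show ?thesis by blast
  qed
  note orbits = orbit_definable [OF this]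
  have "\<not> isomorphic unary_lang ?A ?B"
  proof
    assume "isomorphic unary_lang ?A ?B"
    then obtain h where "bij h" and h: "\<And>x r. T x r \<longleftrightarrow> case_nat b T (h x) r"
      unfolding isomorphic_def isomorphism_unary by blast
    \<comment> \<open>The element 0 of the extension has the infinite type \<open>b\<close>, but the
      type of \<open>x\<close> is bounded by \<open>x\<close>.\<close>
    then obtain x where "h x = 0" by (metis bij_pointE)
    then have "T x r \<longleftrightarrow> b r" for r using h [of x r] by simp
    with inf [of "Suc x"] above [of x] show False by auto
  qed
  moreover have "isomorphic unary_lang ?A ?A"
    unfolding isomorphic_def isomorphism_unary by (rule exI [of _ id]) simp
  \<comment> \<open>The structure satisfies its own Scott sentence, so by transfer the extension
    would satisfy it too and be isomorphic to it.\<close>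
  ultimately have "\<not> (computable_Pi unary_lang 2 0 \<phi> \<and> scott_sentence unary_lang ?A \<phi>)" for \<phi>
    using Pi_2_transfer [OF T lim gen] unfolding computable_Pi_def scott_sentence_def by blast
  moreover have "(\<exists>\<phi>. computable_Sigma unary_lang 1 (length as) \<phi> \<and>
            orbit unary_lang ?A as = defined_set ?A (length as) \<phi>) \<and>
       (\<exists>\<phi>. qf_formula unary_lang (length as) \<phi> \<and>
            orbit unary_lang ?A as = defined_set ?A (length as) \<phi>)" for as
  proof -
    obtain p where p: "qf_over unary_lang p" "qf_vars p \<subseteq> {..<length as}"
      "orbit unary_lang ?A as = defined_set ?A (length as) (QF p)" using orbits by blast
    obtain e \<phi> where \<phi>: "Sigma_index unary_lang (length as) 1 e \<phi>"
      "\<forall>M v. sat M \<phi> v \<longleftrightarrow> qf_sat M v p" using Sigma_1_of_qf [OF p(1,2)] by blast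
    then have "orbit unary_lang ?A as = defined_set ?A (length as) \<phi>"
      by (simp add: p(3) defined_set_def)
    with p \<phi>(1) show ?thesis unfolding computable_Sigma_def qf_formula_def by blast
  qed
  ultimately show ?thesis
    using computable_unary_lang computable_unary_struct [of T, OF T] by blast
qed

end
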